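(* Let $s_n:\mathcal{X}^n\to\mathcal{S}_n$ be a sufficient statistic for $\theta\in\Theta$ and $S_n=s_n(X^n)$. Assume that $G$ acts freely on $\mathcal{S}_n$ and that $s_n(gx^n)=gs_n(x^n)$ for all $x^n\in\mathcal{X}^n$ and $g\in G$. Let $m_{\mathcal{S},n}$ be a maximal invariant for the action of $G$ on $\mathcal{S}_n$, let $M_{\mathcal{S},n}=m_{\mathcal{S},n}(S_n)$, and let $M_{\mathcal{X},n}=m_{\mathcal{X},n}(X^n)$ be a maximally invariant statistic for the action of $G$ on $\mathcal{X}^n$. Then $$\frac{q^{M_{\mathcal{X},n}}(m_{\mathcal{X},n}(X^n))}{p^{M_{\mathcal{X},n}}(m_{\mathcal{X},n}(X^n))}=\frac{q^{M_{\mathcal{S},n}}(m_{\mathcal{S},n}(S_n))}{p^{M_{\mathcal{S},n}}(m_{\mathcal{S},n}(S_n))}.$$ Hence, if in addition $G$ is amenable and there is $\varepsilon>0$ such that $$\mathbf{E}^{\mathbf{Q}}_1\left[\left|\ln\frac{q_1(X^n)}{p_1(X^n)}\right|^{1+\varepsilon}\right]<\infty\quad\text{and}\quad\mathbf{E}^{\mathbf{Q}}_1\left[\left|\ln\frac{q^{M_{\mathcal{X},n}}(M_{\mathcal{X},n})}{p^{M_{\mathcal{X},n}}(M_{\mathcal{X},n})}\right|^{1+\varepsilon}\right]<\infty,$$ then the likelihood ratio for $M_{\mathcal{S},n}$ is GROW and relatively GROW for testing $\mathcal{H}_0:X^n\sim\mathbf{P}_g,\ g\in G$ against $\mathcal{H}_1:X^n\sim\mathbf{Q}_g,\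 g\in G$.
   Context: $G$ is a locally compact Polish topological group (so a Haar measure exists) acting on the observation space $\mathcal{X}^n$ (freely, continuously and properly, i.e. $(g,x)\mapsto(gx,x)$ has compact preimages of compact sets; $\mathcal{X}^n$ locally compact Polish with its Borel $\sigma$-algebra), freely on the parameter space $\Theta$, and continuously on $\mathcal{S}_n$. $\{\mathbf{P}_\theta\}_{\theta\in\Theta}$ is a model for the data $X^n$ that is invariant: $\mathbf{P}_\theta\{X^n\in B\}=\mathbf{P}_{g\theta}\{X^n\in gB\}$ for all $g\in G$, measurable $B$ and $\theta\in\Theta$. $\delta=\delta(\theta)$ is a maximally invariant function of $\theta$; $\delta_0,\delta_1$ are two of its values; fixing $\theta_0,\theta_1$ with $\delta(\theta_j)=\delta_j$, one writes $\mathbf{P}_g=\mathbf{P}_{g\theta_0}$ (null, $\delta(\theta)=\delta_0$) and $\mathbf{Q}_g=\mathbf{P}_{g\theta_1}$ (alternative, $\delta(\theta)=\delta_1$). These have densities $p_g,q_g$ with respect to a common measure $\mu$ on $\mathcal{X}^n$ that is relatively left invariant ($\mu\{gB\}=\chi(g)\mu\{B\}$ for a multiplier $\chi$), and all densities have a single common support (are positive on one and the same set). $\mathbf{E}^{\mathbf{P}}_g,\mathbf{E}^{\mathbf{Q}}_g$ denote expectations; the subindex $1$ is the unit element of $G$. A function $m$ is maximally invariant for an action if $m(x)=m(x')$ iff $x=gx'$ for some $g\in G$. Statistics are measurable with values in standard Borel spaces. The distribution of an invariant statistic $M$ under $\mathbf{P}_g$ (resp. $\mathbf{Q}_g$) does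 not depend on $g$; its density with respect to a common dominating measure is $p^M$ (resp. $q^M$). Likelihood ratios are identified up to almost sure equality. Amenability: there is a sequence $\mathbf{\Pi}_1,\mathbf{\Pi}_2,\dots$ of probability distributions on $G$ with $\lim_{k\to\infty}|\mathbf{\Pi}_k\{B\}-\mathbf{\Pi}_k\{Bg\}|=0$ for every measurable $B\subseteq G$ and $g\in G$. E-statistic: a statistic $T_n=t_n(X^n)\ge0$ with $\sup_{g\in G}\mathbf{E}^{\mathbf{P}}_g[T_n]\le1$. GROW: maximizes $\inf_{g\in G}\mathbf{E}^{\mathbf{Q}}_g[\ln T_n]$ over e-statistics. Relatively GROW: maximizes $\inf_{g\in G}\{\mathbf{E}^{\mathbf{Q}}_g[\ln T_n]-\sup_{T_n'\ \text{e-statistic}}\mathbf{E}^{\mathbf{Q}}_g[\ln T_n']\}$ over e-statistics. *)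

theory Defs
  imports "HOL-Probability.Probability"
begin

text \<open>
  Groups are written additively, because the library's topological groups are those of class
  \<^class>\<open>topological_group_add\<close>. That class is not commutative: \<open>0\<close> is the unit element,
  \<open>g + h\<close> the (possibly noncommutative) product, and \<open>(\<lambda>h. h + g) ` B\<close> the right translate of \<open>B\<close>.
\<close>

definition group_action_on :: "('g::group_add \<Rightarrow> 'a \<Rightarrow> 'a) \<Rightarrow> bool" where
  "group_action_on act \<longleftrightarrow>
     (\<forall>x. act 0 x = x) \<and> (\<forall>g h x. act (g + h) x = act g (act h x))"

definition free_action :: "('g::group_add \<Rightarrow> 'a \<Rightarrow> 'a) \<Rightarrow> bool" where
  "free_action act \<longleftrightarrow> (\<forall>g x. act g x = x \<longrightarrow> g = 0)"

definition continuous_action ::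
    "('g::{group_add,topological_space} \<Rightarrow> 'a::topological_space \<Rightarrow> 'a) \<Rightarrow> bool" where
  "continuous_action act \<longleftrightarrow> continuous_on UNIV (\<lambda>(g, x). act g x)"

definition proper_action ::
    "('g::{group_add,topological_space} \<Rightarrow> 'a::topological_space \<Rightarrow> 'a) \<Rightarrow> bool" where
  "proper_action act \<longleftrightarrow>
     (\<forall>K :: ('a \<times> 'a) set. compact K \<longrightarrow> compact ((\<lambda>(g, x). (act g x, x)) -` K))"

definition maximal_invariant :: "('g \<Rightarrow> 'a \<Rightarrow> 'a) \<Rightarrow> ('a \<Rightarrow> 'm) \<Rightarrow> bool" where
  "maximal_invariant act m \<longleftrightarrow> (\<forall>x x'. m x = m x' \<longleftrightarrow> (\<exists>g. x = act g x'))"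

definition standard_borel :: "'a measure \<Rightarrow> bool" where
  "standard_borel M \<longleftrightarrow>
     (\<exists>T. topspace T = space M \<and> completely_metrizable_space T \<and> second_countable T \<and>
          sets M = sigma_sets (space M) {U. openin T U})"

definition multiplier :: "('g::{group_add,topological_space} \<Rightarrow> real) \<Rightarrow> bool" where
  "multiplier \<kappa> \<longleftrightarrow>
     continuous_on UNIV \<kappa> \<and> (\<forall>g. 0 < \<kappa> g) \<and> (\<forall>g h. \<kappa> (g + h) = \<kappa> g * \<kappa> h)"

definition relatively_left_invariant ::
    "('g \<Rightarrow> 'a \<Rightarrow> 'a) \<Rightarrow> ('g \<Rightarrow> real) \<Rightarrow> 'a measure \<Rightarrow> bool" where
  "relatively_left_invariant act \<kappa> \<mu> \<longleftrightarrow>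
     (\<forall>g. \<forall>B\<in>sets \<mu>. emeasure \<mu> (act g ` B) = ennreal (\<kappa> g) * emeasure \<mu> B)"

definition invariant_model ::
    "('g \<Rightarrow> 'x \<Rightarrow> 'x) \<Rightarrow> ('g \<Rightarrow> 't \<Rightarrow> 't) \<Rightarrow> ('t \<Rightarrow> 'x::topological_space measure) \<Rightarrow> bool" where
  "invariant_model actX actT P \<longleftrightarrow>
     (\<forall>g \<theta>. \<forall>B\<in>sets borel. measure (P \<theta>) B = measure (P (actT g \<theta>)) (actX g ` B))"

text \<open>
  Sufficiency: the conditional probability of every event given the statistic has a version that
  is one and the same function of the statistic for all parameter values.
\<close>

definition sufficient_statistic ::
    "('t \<Rightarrow> 'x::topological_space measure) \<Rightarrow> 's measure \<Rightarrow> ('x \<Rightarrow> 's) \<Rightarrow> bool" where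
  "sufficient_statistic P N s \<longleftrightarrow>
     s \<in> borel \<rightarrow>\<^sub>M N \<and>
     (\<forall>B\<in>sets borel. \<exists>f \<in> borel_measurable N. \<forall>\<theta>.
        AE x in P \<theta>. real_cond_exp (P \<theta>) (vimage_algebra UNIV s N) (indicator B) x = f (s x))"

definition amenable :: "'g::{group_add,topological_space} itself \<Rightarrow> bool" where
  "amenable _ \<longleftrightarrow>
     (\<exists>D :: nat \<Rightarrow> 'g measure.
        (\<forall>k. prob_space (D k) \<and> sets (D k) = sets borel) \<and>
        (\<forall>B\<in>sets borel. \<forall>g.
           (\<lambda>k. \<bar>measure (D k) B - measure (D k) ((\<lambda>h. h + g) ` B)\<bar>) \<longlonglongrightarrow> 0))"

text \<open>
  The logarithm must be \<open>-\<infinity>\<close> at \<open>0\<close>, whereas the library has \<open>ln 0 = 0\<close>. Expectations of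
  logarithms are therefore extended real; an expectation whose positive and negative parts are both
  infinite is counted as \<open>-\<infinity>\<close>.
\<close>

definition ext_ln :: "real \<Rightarrow> ereal" where
  "ext_ln t = (if t \<le> 0 then -\<infinity> else ereal (ln t))"

definition ext_expectation :: "'a measure \<Rightarrow> ('a \<Rightarrow> ereal) \<Rightarrow> ereal" where
  "ext_expectation M f =
     (let pos = (\<integral>\<^sup>+ x. e2ennreal (f x) \<partial>M); neg = (\<integral>\<^sup>+ x. e2ennreal (- f x) \<partial>M)
      in if neg = \<infinity> then -\<infinity> else enn2ereal pos - enn2ereal neg)"

definition e_statistic ::
    "('g \<Rightarrow> 'x::topological_space measure) \<Rightarrow> ('x \<Rightarrow> real) \<Rightarrow> bool" where
  "e_statistic P T \<longleftrightarrow>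
     T \<in> borel_measurable borel \<and> (\<forall>x. 0 \<le> T x) \<and>
     (SUP g. \<integral>\<^sup>+ x. ennreal (T x) \<partial>P g) \<le> 1"

definition GROW ::
    "('g \<Rightarrow> 'x::topological_space measure) \<Rightarrow> ('g \<Rightarrow> 'x measure) \<Rightarrow> ('x \<Rightarrow> real) \<Rightarrow> bool" where
  "GROW P Q T \<longleftrightarrow>
     e_statistic P T \<and>
     (\<forall>T'. e_statistic P T' \<longrightarrow>
        (INF g. ext_expectation (Q g) (\<lambda>x. ext_ln (T' x)))
          \<le> (INF g. ext_expectation (Q g) (\<lambda>x. ext_ln (T x))))"

definition relative_growth ::
    "('g \<Rightarrow> 'x::topological_space measure) \<Rightarrow> ('g \<Rightarrow> 'x measure) \<Rightarrow> ('x \<Rightarrow> real) \<Rightarrow> ereal" where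
  "relative_growth P Q T =
     (INF g. ext_expectation (Q g) (\<lambda>x. ext_ln (T x))
        - (SUP T'\<in>{T'. e_statistic P T'}. ext_expectation (Q g) (\<lambda>x. ext_ln (T' x))))"

definition relatively_GROW ::
    "('g \<Rightarrow> 'x::topological_space measure) \<Rightarrow> ('g \<Rightarrow> 'x measure) \<Rightarrow> ('x \<Rightarrow> real) \<Rightarrow> bool" where
  "relatively_GROW P Q T \<longleftrightarrow>
     e_statistic P T \<and>
     (\<forall>T'. e_statistic P T' \<longrightarrow> relative_growth P Q T' \<le> relative_growth P Q T)"

end

theory Submission
  imports Defs
begin

text \<open>
Write \<open>P\<close> and \<open>Q\<close> for the null and the alternative distribution at the unit element, and \<open>R\<close> for the
likelihood ratio of the maximal invariant of the data.

Equality of the ratios. Let \<open>B\<close> be an invariant event. The conditional probability of \<open>B\<close> given the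
sufficient statistic is the same function for all parameters, so equivariance makes it almost
invariant, and, after correction on a null set, a function of the maximal invariant of the sufficient
statistic (\<open>conditional_probability_of_invariant_event\<close>). Therefore the likelihood ratio of that
smaller invariant already reproduces \<open>Q B\<close> from \<open>P\<close> for every invariant \<open>B\<close>, which is the property
that characterizes \<open>R\<close> (\<open>likelihood_ratio_of_sufficient_maximal_invariant\<close>).

Two measure-theoretic points support this. First, the correction on a null set is usually made with
Haar measure. Here a free proper action has a Borel choice of a point in each orbit
(\<open>borel_orbit_selector\<close>), so the data have a Borel group coordinate, and its law under \<open>P\<close> is a
quasi-invariant probability measure on the group (\<open>right_quasi_invariant_law\<close>), which is all that the
correction needs. Secondly, an invariant event has to be a preimage under a maximal invariant that is
merely measurable; modulo null sets this follows from inner regularity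
(\<open>saturated_borel_set_ae_vimage\<close>).

Optimality. The ratio is an e-statistic with the same growth \<open>K\<close>, the expectation of \<open>ln R\<close> under
\<open>Q\<close>, against every alternative, so the claim is that no e-statistic \<open>T\<close> has worst-case growth above
\<open>K\<close> (\<open>worst_case_growth_bound\<close>). This is a Hunt-Stein argument for log-growth. Average \<open>ln (T (h x))\<close>
over \<open>h\<close> drawn from the asymptotically invariant laws on the group. The average is nearly constant on
orbits, so it may be replaced by its value at the chosen point of the orbit, which is exactly
invariant; by Jensen's inequality its exponential is, up to a vanishing error, still an e-statistic;
and for invariant statistics Gibbs' inequality gives the bound \<open>K\<close>. For this \<open>ln T\<close> must be bounded.
The truncation from above is uniform over the alternatives because the logarithm of the likelihood
ratio of the full data is integrable (\<open>uniformly_small_log_excess\<close>).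

Relative optimality follows because the best growth against a single alternative is a finite number
that, by translation of e-statistics, does not depend on the alternative.
\<close>

section \<open>Likelihood ratios on saturated events\<close>

text \<open>
Blackwell's theorem says that a Borel set that is a union of fibres of \<open>f\<close> is the preimage of
a Borel set under \<open>f\<close>; its proof needs analytic sets. Up to a null set there is an elementary
argument. The law of \<open>(x, f x)\<close> lives on a Polish space, so the graph of \<open>f\<close> over \<open>B\<close> is
exhausted by compact sets up to a null set. Their second projections are compact, hence Borel, and
because \<open>B\<close> is a union of fibres the preimage of their union stays inside \<open>B\<close>.
\<close>

lemma saturated_borel_set_ae_vimage:
  fixes f :: "'x::polish_space \<Rightarrow> 'y::polish_space"
  assumes "finite_measure M" and sets_M: "sets M = sets borel"
    and f [measurable]: "f \<in> borel_measurable borel" and B: "B \<in> sets borel"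
    and saturated: "\<And>x x'. f x = f x' \<Longrightarrow> x \<in> B \<Longrightarrow> x' \<in> B"
  shows "\<exists>C\<in>sets borel. AE x in M. x \<in> B \<longleftrightarrow> f x \<in> C"
proof -
  interpret finite_measure M by fact
  note [measurable_cong] = sets_M
  have [measurable]: "B \<in> sets borel" by fact
  have space_M: "space M = UNIV" using sets_eq_imp_space_eq[OF sets_M] by simp
  define N where "N = distr M borel (\<lambda>x. (x, f x))"
  have pair [measurable]: "(\<lambda>x. (x, f x)) \<in> M \<rightarrow>\<^sub>M borel"
    by (subst borel_prod[symmetric]) measurable
  have N_em: "emeasure N A = emeasure M {x. (x, f x) \<in> A}" if "A \<in> sets borel" for A
    unfolding N_def using that by (subst emeasure_distr) (auto simp: space_M vimage_def)
  interpret N: finite_measure N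
    unfolding N_def by (rule finite_measure_distr) (rule pair)
  define Gr where "Gr = {z. fst z \<in> B \<and> f (fst z) = snd z}"
  have Gr: "Gr \<in> sets borel"
  proof -
    have "{z \<in> space (borel \<Otimes>\<^sub>M borel :: ('x \<times> 'y) measure). fst z \<in> B \<and> f (fst z) = snd z}
        \<in> sets (borel \<Otimes>\<^sub>M borel)"
      by measurable
    then show ?thesis unfolding borel_prod by (simp add: Gr_def)
  qed
  have "emeasure N Gr = (SUP K\<in>{K. K \<subseteq> Gr \<and> compact K}. emeasure N K)"
    by (rule inner_regular) (use Gr N.emeasure_finite in \<open>auto simp: N_def\<close>)
  then obtain K' where K': "range K' \<subseteq> emeasure N ` {K. K \<subseteq> Gr \<and> compact K}"
      "emeasure N Gr = (SUP n::nat. K' n)"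
    using ennreal_SUP_countable_SUP[of "{K. K \<subseteq> Gr \<and> compact K}" "emeasure N"]
    by (metis (mono_tags, lifting) compact_empty empty_Collect_eq empty_subsetI)
  then have "\<forall>n. \<exists>K. K \<subseteq> Gr \<and> compact K \<and> K' n = emeasure N K" by auto
  then obtain K where K: "\<And>n. K n \<subseteq> Gr" "\<And>n. compact (K n)" "\<And>n. K' n = emeasure N (K n)"
    by metis
  have "closed (snd ` K n)" for n
    using K(2) by (intro compact_imp_closed compact_continuous_image continuous_on_snd continuous_on_id)
  then have C [measurable]: "(\<Union>n. snd ` K n) \<in> sets borel" by (intro sets.countable_UN) (auto intro: borel_closed)
  let ?D = "{x. f x \<in> (\<Union>n. snd ` K n)}"
  have D [measurable]: "?D \<in> sets borel"
    using measurable_sets[OF f C] by (simp add: vimage_def)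
  have D_sub: "?D \<subseteq> B"
  proof
    fix x assume "x \<in> ?D"
    then obtain n z where "z \<in> K n" "f x = snd z" by auto
    then have "fst z \<in> B" "f (fst z) = f x" using K(1)[of n] by (auto simp: Gr_def)
    then show "x \<in> B" using saturated by blast
  qed
  have "emeasure M B = emeasure N Gr"
    by (subst N_em[OF Gr]) (simp add: Gr_def)
  also have "\<dots> \<le> emeasure M ?D"
    unfolding K'(2)
  proof (rule SUP_least)
    fix n
    have "K' n = emeasure M {x. (x, f x) \<in> K n}"
      using K(2)[of n] K(3) by (simp add: N_em borel_compact)
    also have "\<dots> \<le> emeasure M ?D"
      using D sets_M by (intro emeasure_mono) force+
    finally show "K' n \<le> emeasure M ?D" .
  qed
  finally have "emeasure M (B - ?D) = 0"
    using B D D_sub sets_M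
    by (subst emeasure_Diff) (auto simp: emeasure_finite less_top[symmetric] intro!: antisym diff_eq_0_ennreal)
  then have "AE x in M. x \<notin> B - ?D"
    using B D sets_M by (intro AE_not_in) auto
  then have "AE x in M. x \<in> B \<longleftrightarrow> f x \<in> (\<Union>n. snd ` K n)"
    by eventually_elim (use D_sub in auto)
  with C show ?thesis by blast
qed

text \<open>
The indicators of a countable base separate the points of a standard Borel space. This reduces
statistics with values in such a space to statistics with values in the Polish space of real
sequences.
\<close>

lemma standard_borel_embedding:
  assumes "standard_borel N"
  shows "\<exists>e :: 'y \<Rightarrow> nat \<Rightarrow> real. e \<in> N \<rightarrow>\<^sub>M borel \<and> inj_on e (space N)"
proof -
  from assms obtain T where T: "topspace T = space N" "completely_metrizable_space T"
      "second_countable T" "sets N = sigma_sets (space N) {U. openin T U}"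
    unfolding standard_borel_def by blast
  from T(3) obtain \<B> where \<B>: "countable \<B>" "\<And>V. V \<in> \<B> \<Longrightarrow> openin T V"
      "\<And>U x. openin T U \<Longrightarrow> x \<in> U \<Longrightarrow> \<exists>V\<in>\<B>. x \<in> V \<and> V \<subseteq> U"
    unfolding second_countable_def by metis
  define b where "b = from_nat_into (insert {} \<B>)"
  have b_open: "openin T (b n)" for n
    using from_nat_into[of "insert {} \<B>" n] \<B>(2) by (auto simp: b_def)
  have b_surj: "\<exists>n. b n = V" if "V \<in> \<B>" for V
    using from_nat_into_surj[of "insert {} \<B>" V] that \<B>(1) by (auto simp: b_def)
  define e :: "'y \<Rightarrow> nat \<Rightarrow> real" where "e y n = indicator (b n) y" for y n
  have b_meas [measurable]: "b n \<in> sets N" for n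
    unfolding T(4) by (rule sigma_sets.Basic) (simp add: b_open)
  have "e \<in> N \<rightarrow>\<^sub>M borel"
    unfolding e_def by (rule measurable_coordinatewise_then_product) measurable
  moreover have "inj_on e (space N)"
  proof (rule inj_onI, rule ccontr)
    fix x y assume xy: "x \<in> space N" "y \<in> space N" "e x = e y" "x \<noteq> y"
    have "Hausdorff_space T"
      using T(2) completely_metrizable_imp_metrizable_space metrizable_imp_Hausdorff_space by blast
    with xy obtain U V where UV: "openin T U" "openin T V" "x \<in> U" "y \<in> V" "disjnt U V"
      unfolding Hausdorff_space_def T(1) by meson
    then obtain W where "W \<in> \<B>" "x \<in> W" "W \<subseteq> U" using \<B>(3) by blast
    then obtain n where "x \<in> b n" "y \<notin> b n" using b_surj UV unfolding disjnt_def by blast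
    then have "e x n \<noteq> e y n" by (simp add: e_def)
    with xy show False by simp
  qed
  ultimately show ?thesis by blast
qed

text \<open>
The Borel events that are unions of fibres of \<open>t\<close>. If \<open>t\<close> is a maximal invariant, these are
exactly the invariant Borel events. Unlike the events \<open>t -` C\<close>, they depend only on the
partition into fibres, so the algebras of two statistics can be compared without exhibiting a
measurable map between them.
\<close>

definition saturated_algebra :: "('x::topological_space \<Rightarrow> 'y) \<Rightarrow> 'x measure" where
  "saturated_algebra t =
     sigma UNIV {B \<in> sets borel. \<forall>x x'. t x = t x' \<longrightarrow> x \<in> B \<longrightarrow> x' \<in> B}"

lemma space_saturated_algebra [simp]: "space (saturated_algebra t) = UNIV"
  by (simp add: saturated_algebra_def space_measure_of_conv)

lemma sets_saturated_algebra:
  fixes t :: "'x::topological_space \<Rightarrow> 'y"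
  shows "sets (saturated_algebra t) = {B \<in> sets borel. \<forall>x x'. t x = t x' \<longrightarrow> x \<in> B \<longrightarrow> x' \<in> B}"
proof -
  let ?S = "{B \<in> sets borel. \<forall>x x'. t x = t x' \<longrightarrow> x \<in> B \<longrightarrow> x' \<in> B}"
  have "sigma_algebra UNIV ?S"
    unfolding sigma_algebra_iff2
  proof (intro conjI ballI allI impI)
    fix B assume B: "B \<in> ?S"
    then have "B \<in> sets borel" by blast
    then have "UNIV - B \<in> sets borel" by (simp add: Compl_eq_Diff_UNIV[symmetric])
    moreover have "x' \<in> UNIV - B" if "t x = t x'" "x \<in> UNIV - B" for x x'
      using B that sym[OF that(1)] by blast
    ultimately show "UNIV - B \<in> ?S" by blast
  next
    fix A :: "nat \<Rightarrow> 'x set" assume A: "range A \<subseteq> ?S"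
    then have "(\<Union>i. A i) \<in> sets borel" by blast
    with A show "(\<Union>i. A i) \<in> ?S" by blast
  qed simp_all
  then have "sigma_sets UNIV ?S = ?S" by (rule sigma_algebra.sigma_sets_eq)
  then show ?thesis by (simp add: saturated_algebra_def sets_measure_of_conv)
qed

lemma measurable_saturated_algebra:
  assumes "h \<in> borel \<rightarrow>\<^sub>M N" and "\<And>x x'. t x = t x' \<Longrightarrow> h x = h x'"
  shows "h \<in> saturated_algebra t \<rightarrow>\<^sub>M N"
proof (rule measurableI)
  fix A assume "A \<in> sets N"
  then have "h -` A \<in> sets borel" using measurable_sets[OF assms(1)] by simp
  moreover have "x' \<in> h -` A" if "t x = t x'" "x \<in> h -` A" for x x'
    using assms(2)[OF that(1)] that(2) by simp
  ultimately show "h -` A \<inter> space (saturated_algebra t) \<in> sets (saturated_algebra t)"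
    unfolding sets_saturated_algebra space_saturated_algebra Int_UNIV_right by blast
qed (use measurable_space[OF assms(1)] in auto)

lemma subalgebra_saturated_algebra:
  assumes "sets M = sets borel"
  shows "subalgebra M (saturated_algebra t)"
  using assms sets_eq_imp_space_eq[OF assms] by (auto simp: subalgebra_def sets_saturated_algebra)

lemma distributed_density_pos:
  assumes f: "\<And>y. 0 \<le> f y" and dist: "distributed M N t (\<lambda>y. ennreal (f y))"
  shows "AE x in M. 0 < f (t x)"
proof -
  have [measurable]: "f \<in> borel_measurable N" "t \<in> M \<rightarrow>\<^sub>M N"
    using distributed_real_measurable[OF f dist] dist by (simp_all add: distributed_def)
  have "AE y in density N (\<lambda>y. ennreal (f y)). 0 < f y" by (subst AE_density) auto
  then have "AE y in distr M N t. 0 < f y" using dist unfolding distributed_def by metis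
  then show ?thesis by (subst (asm) AE_distr_iff) auto
qed

text \<open>
On preimages \<open>t -` C\<close> this is a computation with the two densities; every event of the saturated
algebra is such a preimage up to a null set. Absolute continuity makes the convention
\<open>q / 0 = 0\<close> harmless.
\<close>

lemma likelihood_ratio_on_saturated_algebra:
  fixes t :: "'x::polish_space \<Rightarrow> 'y" and P Q :: "'x measure"
  assumes P: "finite_measure P" "sets P = sets borel" and Q: "sets Q = sets borel"
    and abs_cont: "absolutely_continuous P Q"
    and N: "standard_borel N" and t: "t \<in> borel \<rightarrow>\<^sub>M N"
    and p: "\<And>y. 0 \<le> p y" "distributed P N t (\<lambda>y. ennreal (p y))"
    and q: "\<And>y. 0 \<le> q y" "distributed Q N t (\<lambda>y. ennreal (q y))"
    and h: "h \<in> borel_measurable (saturated_algebra t)"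
  shows "(\<integral>\<^sup>+x. h x \<partial>Q) = (\<integral>\<^sup>+x. ennreal (q (t x) / p (t x)) * h x \<partial>P)"
proof -
  note [measurable_cong] = P(2) Q
  have [measurable]: "t \<in> borel \<rightarrow>\<^sub>M N" by fact
  have space_P: "space P = UNIV" using sets_eq_imp_space_eq[OF P(2)] by simp
  have space_Q: "space Q = UNIV" using sets_eq_imp_space_eq[OF Q] by simp
  have [measurable]: "p \<in> borel_measurable N" "q \<in> borel_measurable N"
    using distributed_real_measurable[OF p(1) p(2)] distributed_real_measurable[OF q(1) q(2)]
    by simp_all
  let ?F = "saturated_algebra t" and ?R = "\<lambda>x. ennreal (q (t x) / p (t x))"
  note sub = subalgebra_saturated_algebra[OF P(2), of t] subalgebra_saturated_algebra[OF Q, of t]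
  have R_F [measurable]: "?R \<in> borel_measurable ?F"
    by (rule measurable_saturated_algebra) (simp_all, measurable)
  have R [measurable]: "?R \<in> borel_measurable borel" by measurable
  have pos: "AE x in Q. 0 < p (t x)"
    by (rule absolutely_continuous_AE[OF _ abs_cont distributed_density_pos[OF p]]) (simp add: P(2) Q)
  \<comment> \<open>The set where \<open>p\<close> vanishes is removed first, because there \<open>p * (q / p)\<close> differs from \<open>q\<close>.\<close>
  have vimage: "emeasure Q {x. t x \<in> C} = (\<integral>\<^sup>+x. ?R x * indicator {x. t x \<in> C} x \<partial>P)"
    if [measurable]: "C \<in> sets N" for C
  proof -
    have "emeasure Q {x. t x \<in> C} = emeasure Q {x. t x \<in> C \<and> 0 < p (t x)}"
      by (rule emeasure_eq_AE) (use pos in \<open>auto simp: pred_def\<close>)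
    also have "\<dots> = emeasure (distr Q N t) {y \<in> space N. y \<in> C \<and> 0 < p y}"
      by (subst emeasure_distr) 
         (use measurable_space[OF t] in \<open>auto simp: space_Q intro!: arg_cong[where f="emeasure Q"]\<close>)
    also have "\<dots> = (\<integral>\<^sup>+y. ennreal (q y) * indicator {y \<in> space N. y \<in> C \<and> 0 < p y} y \<partial>N)"
      using q(2) by (simp add: distributed_def emeasure_density)
    also have "\<dots> = (\<integral>\<^sup>+y. ennreal (p y) * (ennreal (q y / p y) * indicator C y) \<partial>N)"
    proof (rule nn_integral_cong)
      fix y assume "y \<in> space N"
      then show "ennreal (q y) * indicator {y \<in> space N. y \<in> C \<and> 0 < p y} y =
          ennreal (p y) * (ennreal (q y / p y) * indicator C y)"
        using p(1)[of y] q(1)[of y]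
        by (cases "p y = 0") (auto simp: indicator_def ennreal_mult[symmetric])
    qed
    also have "\<dots> = (\<integral>\<^sup>+x. ?R x * indicator C (t x) \<partial>P)"
      by (rule distributed_nn_integral[OF p(2)]) measurable
    finally show ?thesis by (simp add: indicator_def)
  qed
  from standard_borel_embedding[OF N] obtain e :: "'y \<Rightarrow> nat \<Rightarrow> real"
    where e [measurable]: "e \<in> N \<rightarrow>\<^sub>M borel" and inj: "inj_on e (space N)" by blast
  have "restr_to_subalg Q ?F = density (restr_to_subalg P ?F) ?R"
  proof (rule measure_eqI)
    show "sets (restr_to_subalg Q ?F) = sets (density (restr_to_subalg P ?F) ?R)"
      by (simp add: sets_restr_to_subalg[OF sub(1)] sets_restr_to_subalg[OF sub(2)])
    fix B assume "B \<in> sets (restr_to_subalg Q ?F)"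
    then have B: "B \<in> sets ?F" by (simp add: sets_restr_to_subalg[OF sub(2)])
    have B_borel [measurable]: "B \<in> sets borel"
      and B_sat: "\<And>x x'. t x = t x' \<Longrightarrow> x \<in> B \<Longrightarrow> x' \<in> B"
      using B unfolding sets_saturated_algebra by blast+
    have "\<exists>C\<in>sets borel. AE x in P. x \<in> B \<longleftrightarrow> (e \<circ> t) x \<in> C"
    proof (rule saturated_borel_set_ae_vimage)
      fix x x' assume "(e \<circ> t) x = (e \<circ> t) x'"
      then have "t x = t x'"
        using inj measurable_space[OF t] by (auto dest: inj_onD)
      then show "x \<in> B \<Longrightarrow> x' \<in> B" by (rule B_sat)
    qed (use P B_borel measurable_comp[OF t e] in simp_all)
    then obtain C where [measurable]: "C \<in> sets borel" and C: "AE x in P. x \<in> B \<longleftrightarrow> e (t x) \<in> C"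
      by auto
    have C_Q: "AE x in Q. x \<in> B \<longleftrightarrow> e (t x) \<in> C"
      by (rule absolutely_continuous_AE[OF _ abs_cont C]) (simp add: P(2) Q)
    let ?C = "e -` C \<inter> space N"
    have C_eq: "{x. t x \<in> ?C} = {x. e (t x) \<in> C}"
      using measurable_space[OF t] by auto
    have "emeasure (restr_to_subalg Q ?F) B = emeasure Q B"
      by (rule emeasure_restr_to_subalg[OF sub(2) B])
    also have "\<dots> = emeasure Q {x. t x \<in> ?C}"
      unfolding C_eq by (rule emeasure_eq_AE) (use C_Q in \<open>auto simp: pred_def\<close>)
    also have "\<dots> = (\<integral>\<^sup>+x. ?R x * indicator {x. t x \<in> ?C} x \<partial>P)"
      by (rule vimage) measurable
    also have "\<dots> = (\<integral>\<^sup>+x. ?R x * indicator B x \<partial>P)"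
      unfolding C_eq by (rule nn_integral_cong_AE) (use C in \<open>auto split: split_indicator\<close>)
    also have "\<dots> = (\<integral>\<^sup>+x. ?R x * indicator B x \<partial>restr_to_subalg P ?F)"
      by (rule nn_integral_subalgebra2[symmetric, OF sub(1)]) (use B in measurable)
    also have "\<dots> = emeasure (density (restr_to_subalg P ?F) ?R) B"
      using B by (subst emeasure_density) 
        (auto simp: sets_restr_to_subalg[OF sub(1)] intro: measurable_in_subalg[OF sub(1)] R_F)
    finally show "emeasure (restr_to_subalg Q ?F) B = emeasure (density (restr_to_subalg P ?F) ?R) B" .
  qed
  then have "(\<integral>\<^sup>+x. h x \<partial>restr_to_subalg Q ?F) = (\<integral>\<^sup>+x. ?R x * h x \<partial>restr_to_subalg P ?F)"
    by (simp add: nn_integral_density measurable_in_subalg[OF sub(1)] R_F h)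
  then show ?thesis
    using nn_integral_subalgebra2[OF sub(2) h]
      nn_integral_subalgebra2[OF sub(1) borel_measurable_times_ennreal[OF R_F h]] by simp
qed

section \<open>Borel orbit representatives\<close>

lemma compact_insert_limit_range:
  fixes f :: "nat \<Rightarrow> 'a::topological_space"
  assumes "f \<longlonglongrightarrow> l"
  shows "compact (insert l (range f))"
  unfolding compact_eq_Heine_Borel
proof (intro allI impI, elim conjE)
  fix \<C> assume \<C>: "\<forall>U\<in>\<C>. open U" "insert l (range f) \<subseteq> \<Union>\<C>"
  then obtain U where U: "U \<in> \<C>" "l \<in> U" by blast
  then have "eventually (\<lambda>n. f n \<in> U) sequentially"
    using topological_tendstoD[OF assms] \<C>(1) by blast
  then obtain N where N: "\<And>n. n \<ge> N \<Longrightarrow> f n \<in> U" by (auto simp: eventually_sequentially)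
  have "\<forall>n. \<exists>V\<in>\<C>. f n \<in> V" using \<C>(2) by blast
  then obtain V where V: "\<And>n. V n \<in> \<C>" "\<And>n. f n \<in> V n" by metis
  have "f n \<in> U \<or> n \<in> {..<N}" for n using N[of n] by (cases "n \<ge> N") auto
  then have "insert l (range f) \<subseteq> \<Union>(insert U (V ` {..<N}))" using U V(2) by blast
  then show "\<exists>\<C>'\<subseteq>\<C>. finite \<C>' \<and> insert l (range f) \<subseteq> \<Union>\<C>'"
    using U V(1) by (intro exI[of _ "insert U (V ` {..<N})"]) auto
qed

text \<open>
A list of indices is read from its end: the last entry selects a member of the first cover
\<open>U 0\<close>, the head a member of the latest one, so that a path grows at its head.
\<close>

primrec cell :: "(nat \<Rightarrow> nat \<Rightarrow> 'x set) \<Rightarrow> nat list \<Rightarrow> 'x set" where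
  "cell U [] = UNIV"
| "cell U (n # l) = cell U l \<inter> U (length l) n"

text \<open>
The greedy path through the cells that are hit, where \<open>H V\<close> is read as ``\<open>V\<close> is hit''.
\<close>

primrec least_path :: "('x set \<Rightarrow> bool) \<Rightarrow> (nat \<Rightarrow> nat \<Rightarrow> 'x set) \<Rightarrow> nat \<Rightarrow> nat list" where
  "least_path H U 0 = []"
| "least_path H U (Suc k) = (LEAST n. H (cell U (n # least_path H U k))) # least_path H U k"

lemma length_least_path [simp]: "length (least_path H U k) = k"
  by (induction k) auto

lemma cell_least_path_subset:
  "k < m \<Longrightarrow> cell U (least_path H U m) \<subseteq> U k (hd (least_path H U (Suc k)))"
proof (induction m)
  case (Suc m)
  show ?case
  proof (cases "k = m")
    case True
    then show ?thesis by simp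
  next
    case False
    then have "cell U (least_path H U m) \<subseteq> U k (hd (least_path H U (Suc k)))"
      using Suc by simp
    then show ?thesis by auto
  qed
qed simp

lemma open_cell: "(\<And>k n. open (U k n)) \<Longrightarrow> open (cell U l)"
  by (induction l) auto

locale free_proper_action =
  fixes act :: "'g::{topological_group_add,polish_space} \<Rightarrow> 'x::polish_space \<Rightarrow> 'x"
  assumes group: "group_action_on act" and free: "free_action act"
    and continuous: "continuous_action act" and proper: "proper_action act"
begin

lemma act_zero [simp]: "act 0 x = x"
  and act_add: "act (g + h) x = act g (act h x)"
  using group by (auto simp: group_action_on_def)

lemma act_minus_cancel [simp]: "act (- g) (act g x) = x" "act g (act (- g) x) = x"
  by (simp_all flip: act_add)

lemma act_eq_iff: "act g x = act h x \<longleftrightarrow> g = h"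
proof
  assume "act g x = act h x"
  then have "act (- h + g) x = x" by (simp add: act_add)
  then have "- h + g = 0" using free by (auto simp: free_action_def)
  then show "g = h" by (metis add.inverse_inverse minus_unique)
qed simp

lemma continuous_on_act: "continuous_on UNIV (\<lambda>z. act (fst z) (snd z))"
  using continuous by (simp add: continuous_action_def case_prod_unfold)

lemma measurable_act [measurable (raw)]:
  assumes "f \<in> borel_measurable M" "h \<in> borel_measurable M"
  shows "(\<lambda>z. act (f z) (h z)) \<in> borel_measurable M"
  using assms continuous_on_act by (rule borel_measurable_continuous_Pair)

lemma open_act_vimage:
  assumes "open V" shows "open {x. act g x \<in> V}"
proof -
  have "continuous_on UNIV (\<lambda>x. (g, x))" by (intro continuous_intros)
  from continuous_on_compose2[OF continuous_on_act this]
  have "continuous_on UNIV (\<lambda>x. act g x)" by simp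
  then show ?thesis using assms by (simp add: continuous_on_open_vimage[OF open_UNIV] vimage_def)
qed

text \<open>
Properness enters here: a convergent sequence of pairs \<open>(g\<^sub>n y\<^sub>n, y\<^sub>n)\<close> together with its limit is
compact, so its preimage is, and the \<open>g\<^sub>n\<close> have a convergent subsequence. With \<open>F = UNIV\<close> this
makes orbits closed; with general \<open>F\<close> it makes the group element that connects two points of an
orbit a Borel function of them.
\<close>

lemma closed_action_graph:
  assumes "closed F"
  shows "closed {(x, y). \<exists>g\<in>F. x = act g y}"
  unfolding closed_sequential_limits
proof (intro allI impI, elim conjE)
  fix z l assume z: "\<forall>n. z n \<in> {(x, y). \<exists>g\<in>F. x = act g y}" and lim: "z \<longlonglongrightarrow> l"
  from z have "\<forall>n. \<exists>g\<in>F. fst (z n) = act g (snd (z n))" by (auto simp: case_prod_unfold)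
  then obtain g where g: "\<And>n. g n \<in> F" "\<And>n. fst (z n) = act (g n) (snd (z n))" by metis
  let ?\<Phi> = "\<lambda>(g, x). (act g x, x)"
  define K where "K = ?\<Phi> -` insert l (range z)"
  have "compact K"
    unfolding K_def using proper compact_insert_limit_range[OF lim] by (auto simp: proper_action_def)
  then have K: "seq_compact K" by (rule compact_imp_seq_compact)
  have K_mem: "(g n, snd (z n)) \<in> K" for n
  proof -
    have "?\<Phi> (g n, snd (z n)) = z n" using g(2)[of n] by (simp add: prod_eq_iff)
    then show ?thesis by (simp add: K_def vimage_def)
  qed
  obtain w r where w: "strict_mono (r :: nat \<Rightarrow> nat)" "w \<in> K"
      "((\<lambda>n. (g n, snd (z n))) \<circ> r) \<longlonglongrightarrow> w"
    by (rule seq_compactE[OF K]) (use K_mem in auto)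
  have lims: "(\<lambda>n. g (r n)) \<longlonglongrightarrow> fst w" "(\<lambda>n. snd (z (r n))) \<longlonglongrightarrow> snd w"
    using tendsto_fst[OF w(3)] tendsto_snd[OF w(3)] by (simp_all add: o_def)
  have "(\<lambda>n. act (g (r n)) (snd (z (r n)))) \<longlonglongrightarrow> act (fst w) (snd w)"
    using continuous_on_tendsto_compose[OF continuous_on_act w(3)] by (simp add: o_def)
  then have "(\<lambda>n. fst (z (r n))) \<longlonglongrightarrow> act (fst w) (snd w)"
    by (simp add: g(2))
  moreover have zr: "(\<lambda>n. z (r n)) \<longlonglongrightarrow> l"
    using LIMSEQ_subseq_LIMSEQ[OF lim w(1)] by (simp add: o_def)
  ultimately have "fst l = act (fst w) (snd w)"
    using LIMSEQ_unique tendsto_fst[OF zr] by blast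
  moreover have "snd l = snd w" using LIMSEQ_unique tendsto_snd[OF zr] lims(2) by blast
  moreover have "fst w \<in> F" using closed_sequentially[OF assms _ lims(1)] g(1) by simp
  ultimately show "l \<in> {(x, y). \<exists>g\<in>F. x = act g y}" by (auto simp: case_prod_unfold)
qed

lemma closed_orbit: "closed (range (\<lambda>g. act g x))"
proof -
  have "closed ((\<lambda>y. (y, x)) -` {(x, y). \<exists>g\<in>UNIV. x = act g y})"
    by (intro closed_vimage closed_action_graph closed_UNIV continuous_intros)
  also have "(\<lambda>y. (y, x)) -` {(x, y). \<exists>g\<in>UNIV. x = act g y} = range (\<lambda>g. act g x)" by auto
  finally show ?thesis .
qed

text \<open>
Cover the space by balls of radius \<open>(1/2) ^ k\<close> around a countable dense set and follow the least path
of balls whose intersection still meets the orbit of \<open>x\<close>. The centres converge to a point that is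
in the orbit, because orbits are closed. The point depends on the orbit only, and it is a Borel
function of \<open>x\<close>, because the points whose orbit meets an open set form an open set.
\<close>

lemma borel_orbit_selector:
  "\<exists>\<sigma>\<in>borel_measurable borel. (\<forall>x. \<exists>g. x = act g (\<sigma> x)) \<and> (\<forall>g x. \<sigma> (act g x) = \<sigma> x)"
proof -
  obtain D :: "'x set" where D: "countable D" "\<And>V. open V \<Longrightarrow> V \<noteq> {} \<Longrightarrow> \<exists>d\<in>D. d \<in> V"
    using countable_dense_setE[where 'a='x] by blast
  define c where "c = from_nat_into D"
  have "D \<noteq> {}" using D(2)[OF open_UNIV] by auto
  have c: "\<exists>n. c n \<in> V" if "open V" "V \<noteq> {}" for V
    using D(2)[OF that] from_nat_into_surj[OF D(1)] unfolding c_def by metis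
  define U where "U k n = ball (c n) ((1/2::real) ^ k)" for k n
  define meets where "meets x V \<longleftrightarrow> (\<exists>g. act g x \<in> V)" for x V
  define path where "path x = least_path (meets x) U" for x
  have open_U: "open (U k n)" for k n by (simp add: U_def)
  have meets_act: "meets (act h x) = meets x" for h x
  proof (rule ext)
    fix V
    show "meets (act h x) V = meets x V"
      unfolding meets_def by (metis act_add act_minus_cancel(1))
  qed
  have meets_path: "meets x (cell U (path x k))" for x k
  proof (induction k)
    case 0
    then show ?case by (simp add: path_def meets_def)
  next
    case (Suc k)
    then obtain g where g: "act g x \<in> cell U (path x k)" by (auto simp: meets_def)
    obtain n where "c n \<in> ball (act g x) ((1/2) ^ k)" using c[of "ball (act g x) ((1/2) ^ k)"] by (auto simp: not_le)
    then have "act g x \<in> cell U (n # path x k)"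
      using g by (simp add: U_def path_def dist_commute)
    then have "meets x (cell U (n # path x k))" unfolding meets_def by blast
    then have "meets x (cell U ((LEAST n. meets x (cell U (n # path x k))) # path x k))"
      by (rule LeastI)
    then show ?case by (simp only: path_def least_path.simps)
  qed
  define a where "a k x = c (hd (path x (Suc k)))" for k x
  have "\<exists>w. w \<in> range (\<lambda>g. act g x) \<and> (\<forall>k<m. dist (a k x) w < (1/2) ^ k)" for x m
  proof -
    obtain g where "act g x \<in> cell U (path x m)" using meets_path[of x m] by (auto simp: meets_def)
    then have "dist (a k x) (act g x) < (1/2) ^ k" if "k < m" for k
      using cell_least_path_subset[OF that, of U "meets x"] by (auto simp: U_def a_def path_def)
    then show ?thesis by blast
  qed
  then obtain w where w: "\<And>x m. w x m \<in> range (\<lambda>g. act g x)"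
      "\<And>x k m. k < m \<Longrightarrow> dist (a k x) (w x m) < (1/2) ^ k" by metis
  have a_dist: "dist (a k x) (a m x) < 2 * (1/2) ^ k" if "k \<le> m" for k m x
  proof -
    have "dist (a k x) (a m x) \<le> dist (a k x) (w x (Suc m)) + dist (a m x) (w x (Suc m))"
      by (rule dist_triangle2)
    also have "\<dots> < (1/2) ^ k + (1/2) ^ m" using that by (intro add_strict_mono w(2)) auto
    also have "\<dots> \<le> (1/2) ^ k + (1/2) ^ k" using that by (intro add_left_mono power_decreasing) auto
    finally show ?thesis by simp
  qed
  have half: "(\<lambda>k. 4 * (1/2::real) ^ k) \<longlonglongrightarrow> 0"
    by (intro tendsto_mult_right_zero LIMSEQ_power_zero) simp
  have "Cauchy (\<lambda>k. a k x)" for x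
  proof (rule metric_CauchyI)
    fix e :: real assume "0 < e"
    then obtain N where N: "4 * (1/2::real) ^ N < e"
      using order_tendstoD(2)[OF half] by (meson eventually_sequentially order_refl)
    have "dist (a m x) (a n x) < e" if "N \<le> m" "N \<le> n" for m n
      using a_dist[OF that(1), of x] a_dist[OF that(2), of x] N
        dist_triangle3[of "a m x" "a n x" "a N x"] by linarith
    then show "\<exists>N. \<forall>m\<ge>N. \<forall>n\<ge>N. dist (a m x) (a n x) < e" by blast
  qed
  then have "\<forall>x. \<exists>l. (\<lambda>k. a k x) \<longlonglongrightarrow> l" using Cauchy_convergent convergent_def by metis
  then obtain \<sigma> where \<sigma>: "\<And>x. (\<lambda>k. a k x) \<longlonglongrightarrow> \<sigma> x" by metis
  have meas_meets [measurable]: "(\<lambda>x. meets x V) \<in> measurable borel (count_space UNIV)"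
    if "open V" for V
  proof -
    have "{x. meets x V} = (\<Union>g. {x. act g x \<in> V})" by (auto simp: meets_def)
    then have "open {x. meets x V}" using open_act_vimage[OF that] by auto
    then show ?thesis by (simp add: pred_def borel_open)
  qed
  have path_meas: "(\<lambda>x. path x k) \<in> measurable borel (count_space UNIV)" for k
  proof (induction k)
    case 0
    then show ?case by (simp add: path_def)
  next
    case (Suc k)
    have "(\<lambda>x. (LEAST n. meets x (cell U (n # l))) # l) \<in> measurable borel (count_space UNIV)" for l
      by (rule measurable_compose[where g="\<lambda>n. n # l" and N="count_space UNIV"])
         (intro measurable_Least meas_meets open_cell open_U, simp)
    from measurable_compose_countable[OF this Suc]
    show ?case by (simp only: path_def least_path.simps)
  qed
  have "(\<lambda>x. a k x) \<in> borel_measurable borel" for k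
    unfolding a_def by (rule measurable_compose[OF path_meas]) simp
  then have "\<sigma> \<in> borel_measurable borel"
    by (rule borel_measurable_LIMSEQ_metric) (rule \<sigma>)
  moreover have "\<exists>g. x = act g (\<sigma> x)" for x
  proof -
    have "(\<lambda>m. w x (Suc m)) \<longlonglongrightarrow> \<sigma> x"
    proof (rule tendsto_dist_iff[THEN iffD2], rule tendsto_sandwich[OF _ _ tendsto_const])
      have "(\<lambda>m. (1/2::real) ^ m + dist (a m x) (\<sigma> x)) \<longlonglongrightarrow> 0 + 0"
        using tendsto_dist_iff[THEN iffD1, OF \<sigma>[of x]] by (intro tendsto_add LIMSEQ_power_zero) auto
      then show "(\<lambda>m. (1/2::real) ^ m + dist (a m x) (\<sigma> x)) \<longlonglongrightarrow> 0" by simp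
      have "dist (w x (Suc m)) (\<sigma> x) \<le> (1/2) ^ m + dist (a m x) (\<sigma> x)" for m
        using dist_triangle3[of "w x (Suc m)" "\<sigma> x" "a m x"] w(2)[of m "Suc m" x] by simp
      then show "\<forall>\<^sub>F m in sequentially. dist (w x (Suc m)) (\<sigma> x) \<le> (1/2) ^ m + dist (a m x) (\<sigma> x)"
        by simp
    qed simp
    then have "\<sigma> x \<in> range (\<lambda>g. act g x)"
      by (rule closed_sequentially[OF closed_orbit w(1)])
    then obtain g where "\<sigma> x = act g x" by blast
    then show ?thesis by (metis act_minus_cancel(1))
  qed
  moreover have "\<sigma> (act g x) = \<sigma> x" for g x
  proof -
    have "(\<lambda>k. a k (act g x)) = (\<lambda>k. a k x)" by (simp add: a_def path_def meets_act)
    then show ?thesis using \<sigma>[of "act g x"] \<sigma>[of x] LIMSEQ_unique by auto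
  qed
  ultimately show ?thesis by blast
qed

definition orbit_rep :: "'x \<Rightarrow> 'x" where
  "orbit_rep = (SOME \<sigma>. \<sigma> \<in> borel_measurable borel \<and> (\<forall>x. \<exists>g. x = act g (\<sigma> x)) \<and>
     (\<forall>g x. \<sigma> (act g x) = \<sigma> x))"

lemma measurable_orbit_rep [measurable]: "orbit_rep \<in> borel_measurable borel"
  and orbit_rep_in_orbit: "\<exists>g. x = act g (orbit_rep x)"
  and orbit_rep_act [simp]: "orbit_rep (act g x) = orbit_rep x"
proof -
  have "\<exists>\<sigma>. \<sigma> \<in> borel_measurable borel \<and> (\<forall>x. \<exists>g. x = act g (\<sigma> x)) \<and> (\<forall>g x. \<sigma> (act g x) = \<sigma> x)"
    using borel_orbit_selector by blast
  from someI_ex[OF this]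
  show "orbit_rep \<in> borel_measurable borel" "\<exists>g. x = act g (orbit_rep x)"
    "orbit_rep (act g x) = orbit_rep x"
    unfolding orbit_rep_def by auto
qed

text \<open>
Together with \<open>orbit_rep\<close> it identifies the space with a product of the group and the set of
orbits; this is the group coordinate.
\<close>

definition displacement :: "'x \<Rightarrow> 'g" where
  "displacement x = (THE g. x = act g (orbit_rep x))"

lemma displacement_eqI: "x = act g (orbit_rep x) \<Longrightarrow> displacement x = g"
  unfolding displacement_def by (rule the_equality) (metis act_eq_iff)+

lemma act_displacement [simp]: "act (displacement x) (orbit_rep x) = x"
  using orbit_rep_in_orbit[of x] displacement_eqI by metis

lemma displacement_act: "displacement (act h x) = h + displacement x"
  by (rule displacement_eqI) (simp add: act_add)

lemma measurable_displacement [measurable]: "displacement \<in> borel_measurable borel"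
proof (rule borel_measurableI)
  fix S :: "'g set" assume "open S"
  let ?E = "{(x, y). \<exists>g\<in>-S. x = act g y}"
  have "closed ?E" using \<open>open S\<close> by (intro closed_action_graph) (simp add: closed_def)
  then have E: "?E \<in> sets (borel \<Otimes>\<^sub>M borel)" unfolding borel_prod by (rule borel_closed)
  have "(\<lambda>x. (x, orbit_rep x)) \<in> borel \<rightarrow>\<^sub>M borel \<Otimes>\<^sub>M borel" by measurable
  from measurable_sets[OF this sets.compl_sets[OF E]]
  have "{x. (x, orbit_rep x) \<notin> ?E} \<in> sets borel"
    by (simp add: vimage_def space_pair_measure)
  moreover have "displacement x \<in> S \<longleftrightarrow> (x, orbit_rep x) \<notin> ?E" for x
    using act_displacement[of x] displacement_eqI[of x] by force
  then have "displacement -` S = {x. (x, orbit_rep x) \<notin> ?E}" by auto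
  ultimately show "displacement -` S \<inter> space borel \<in> sets borel" by simp
qed

end

section \<open>Conditional probabilities of invariant events given a sufficient statistic\<close>

lemma distr_action_invariant_model:
  fixes actX :: "'g::group_add \<Rightarrow> 'x::topological_space \<Rightarrow> 'x"
  assumes "invariant_model actX actT P" "group_action_on actX"
    and model: "\<And>\<theta>. prob_space (P \<theta>)" "\<And>\<theta>. sets (P \<theta>) = sets borel"
    and act: "actX g \<in> borel_measurable borel"
  shows "P (actT g \<theta>) = distr (P \<theta>) borel (actX g)"
proof (rule measure_eqI)
  fix B assume "B \<in> sets (P (actT g \<theta>))"
  then have B: "B \<in> sets borel" by (simp add: model)
  interpret P: prob_space "P \<theta>" by (rule model)
  interpret P': prob_space "P (actT g \<theta>)" by (rule model)
  have act': "actX g \<in> P \<theta> \<rightarrow>\<^sub>M borel" using act by (simp add: measurable_cong_sets[OF model(2) refl])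
  have cancel: "actX g (actX (- g) x) = x" for x
    using assms(2) unfolding group_action_on_def by (metis add.right_inverse)
  have "actX g ` (actX g -` B) = B"
    using cancel by (auto simp: image_iff) (metis cancel)
  then have "measure (P (actT g \<theta>)) B = measure (P \<theta>) (actX g -` B)"
    using assms(1) measurable_sets[OF act B] unfolding invariant_model_def
    by (metis Int_UNIV_right space_borel)
  also have "\<dots> = measure (distr (P \<theta>) borel (actX g)) B"
    using B act' sets_eq_imp_space_eq[OF model(2)[of \<theta>]] by (simp add: measure_distr)
  finally show "emeasure (P (actT g \<theta>)) B = emeasure (distr (P \<theta>) borel (actX g)) B"
    using prob_space.finite_measure[OF P.prob_space_distr[OF act']]
    by (simp add: P'.emeasure_eq_measure finite_measure.emeasure_eq_measure)
qed (simp add: model)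

context free_proper_action
begin

text \<open>
A substitute for Haar measure. If \<open>P\<close> is quasi-invariant, then so is the law on the group of the
group coordinate of a random point, and it is a probability measure. Inverting the coordinate
turns left translations, by which the group acts on it, into right translations.
\<close>

lemma right_quasi_invariant_law:
  assumes "prob_space P" and sets_P: "sets P = sets borel"
    and quasi: "\<And>g A. A \<in> null_sets P \<Longrightarrow> {x. act g x \<in> A} \<in> null_sets P"
  shows "\<exists>\<Lambda> :: 'g measure. prob_space \<Lambda> \<and> sets \<Lambda> = sets borel \<and>
    (\<forall>h. \<forall>B\<in>null_sets \<Lambda>. {k. k + h \<in> B} \<in> null_sets \<Lambda>)"
proof (intro exI conjI allI ballI)
  interpret prob_space P by fact
  note [measurable_cong] = sets_P
  have space_P: "space P = UNIV" using sets_eq_imp_space_eq[OF sets_P] by simp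
  have "continuous_on UNIV (uminus :: 'g \<Rightarrow> 'g)" by (intro continuous_intros)
  from measurable_compose[OF measurable_displacement borel_measurable_continuous_onI[OF this]]
  have [measurable]: "(\<lambda>x. - displacement x) \<in> borel_measurable borel" .
  let ?\<Lambda> = "distr P borel (\<lambda>x. - displacement x)"
  show "prob_space ?\<Lambda>" by (rule prob_space_distr) measurable
  show "sets ?\<Lambda> = sets borel" by simp
  fix h B assume "B \<in> null_sets ?\<Lambda>"
  then have B [measurable]: "B \<in> sets borel" and null: "{x. - displacement x \<in> B} \<in> null_sets P"
    by (auto simp: null_sets_distr_iff space_P vimage_def)
  have "- displacement x + h = - displacement (act (- h) x)" for x
    by (simp add: displacement_act minus_add)
  then have "{x. - displacement x + h \<in> B} = {x. act (- h) x \<in> {x. - displacement x \<in> B}}" by simp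
  then have "{x. - displacement x + h \<in> B} \<in> null_sets P" using quasi[OF null] by metis
  moreover have "continuous_on UNIV (\<lambda>k. k + h)" by (intro continuous_intros)
  from measurable_sets[OF borel_measurable_continuous_onI[OF this] B]
  have "{k. k + h \<in> B} \<in> sets borel" by (simp add: vimage_def)
  ultimately show "{k. k + h \<in> B} \<in> null_sets ?\<Lambda>"
    by (simp add: null_sets_distr_iff space_P vimage_def)
qed

text \<open>
The exceptional null set of almost invariance depends on the group element. By Fubini, almost
every \<open>x\<close> has the property that \<open>g \<mapsto> \<phi> (g x)\<close> is almost everywhere constant for a fixed
right quasi-invariant law, and quasi-invariance makes this set of points and the constant
invariant. The last clause says more than invariance: \<open>\<psi> x\<close> depends only on the function
\<open>g \<mapsto> \<phi> (g x)\<close> modulo right translation. Hence if \<open>\<phi>\<close> factors through an equivariant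
statistic, then \<open>\<psi>\<close> is a function of the orbit of that statistic.
\<close>

lemma smoothing_almost_invariant:
  fixes \<phi> :: "'x \<Rightarrow> real"
  assumes "prob_space P" and sets_P: "sets P = sets borel"
    and quasi: "\<And>g A. A \<in> null_sets P \<Longrightarrow> {x. act g x \<in> A} \<in> null_sets P"
    and \<phi> [measurable]: "\<phi> \<in> borel_measurable borel"
    and bounds: "\<And>x. 0 \<le> \<phi> x" "\<And>x. \<phi> x \<le> 1"
    and almost_invariant: "\<And>g. AE x in P. \<phi> (act g x) = \<phi> x"
  shows "\<exists>\<psi>\<in>borel_measurable borel. (\<forall>x. 0 \<le> \<psi> x) \<and> (AE x in P. \<psi> x = \<phi> x) \<and>
    (\<forall>x x' h. (\<forall>g. \<phi> (act g x) = \<phi> (act (g + h) x')) \<longrightarrow> \<psi> x = \<psi> x')"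
proof -
  interpret P: prob_space P by fact
  obtain \<Lambda> :: "'g measure" where "prob_space \<Lambda>" and sets_\<Lambda> [measurable_cong]: "sets \<Lambda> = sets borel"
    and \<Lambda>_quasi: "\<And>h B. B \<in> null_sets \<Lambda> \<Longrightarrow> {k. k + h \<in> B} \<in> null_sets \<Lambda>"
    using right_quasi_invariant_law[OF assms(1-3)] by blast
  interpret \<Lambda>: prob_space \<Lambda> by fact
  interpret pair_sigma_finite P \<Lambda> ..
  note [measurable_cong] = sets_P
  have space_\<Lambda>: "space \<Lambda> = UNIV" and space_P: "space P = UNIV"
    using sets_eq_imp_space_eq[OF sets_\<Lambda>] sets_eq_imp_space_eq[OF sets_P] by simp_all
  define I where "I x = (\<integral>g. \<phi> (act g x) \<partial>\<Lambda>)" for x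
  \<comment> \<open>Almost everywhere constancy is written as a vanishing integral, which is measurable in \<open>x\<close>.\<close>
  define D where "D x \<longleftrightarrow> (\<integral>\<^sup>+g. ennreal \<bar>\<phi> (act g x) - I x\<bar> \<partial>\<Lambda>) = 0" for x
  define \<psi> where "\<psi> x = (if D x then I x else 0)" for x
  have I_meas [measurable]: "I \<in> borel_measurable borel"
    unfolding I_def by measurable
  have D_meas [measurable]: "Measurable.pred borel D"
    unfolding D_def by measurable
  have D_iff: "D x \<longleftrightarrow> (AE g in \<Lambda>. \<phi> (act g x) = I x)" for x
    unfolding D_def by (subst nn_integral_0_iff_AE) auto
  have I_eqI: "I x = c" if "AE g in \<Lambda>. \<phi> (act g x) = c" for x c
  proof -
    have "I x = (\<integral>g. c \<partial>\<Lambda>)" unfolding I_def by (rule integral_cong_AE) (use that in measurable)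
    then show ?thesis by (simp add: \<Lambda>.prob_space)
  qed
  have D_eqI: "D x" if "AE g in \<Lambda>. \<phi> (act g x) = c" for x c
    using that I_eqI[OF that] by (simp add: D_iff)
  have transport: "D x \<and> I x = I x'"
    if "D x'" and eq: "\<And>g. \<phi> (act g x) = \<phi> (act (g + h) x')" for x x' h
  proof -
    have "{g. \<phi> (act g x') \<noteq> I x'} \<in> null_sets \<Lambda>"
      using that(1) by (simp add: D_iff AE_iff_null space_\<Lambda> sets_\<Lambda>)
    from \<Lambda>_quasi[OF this, of h] have "{g. \<phi> (act g x) \<noteq> I x'} \<in> null_sets \<Lambda>" by (simp add: eq)
    then have "AE g in \<Lambda>. \<phi> (act g x) = I x'" by (simp add: AE_iff_null space_\<Lambda> sets_\<Lambda>)
    then show ?thesis using I_eqI D_eqI by blast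
  qed
  have "\<psi> x = \<psi> x'" if "\<And>g. \<phi> (act g x) = \<phi> (act (g + h) x')" for x x' h
  proof -
    have "\<phi> (act g x') = \<phi> (act (g + - h) x)" for g using that[of "g + - h"] by (simp add: add.assoc)
    then show ?thesis using transport[of x' x h] transport[of x x' "- h"] that
      unfolding \<psi>_def by (metis (no_types, lifting))
  qed
  moreover have "AE x in P. \<psi> x = \<phi> x"
  proof -
    have "AE g in \<Lambda>. AE x in P. \<phi> (act g x) = \<phi> x" using almost_invariant by simp
    then have "AE x in P. AE g in \<Lambda>. \<phi> (act g x) = \<phi> x"
      by (subst AE_commute) (auto simp: space_P space_\<Lambda>)
    then show ?thesis
      by eventually_elim (use I_eqI D_eqI in \<open>auto simp: \<psi>_def\<close>)
  qed
  moreover have "0 \<le> \<psi> x" for x unfolding \<psi>_def I_def using bounds by simp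
  moreover have "\<psi> \<in> borel_measurable borel" unfolding \<psi>_def by measurable
  ultimately show ?thesis by blast
qed

text \<open>
Let \<open>k (s x)\<close> be the version of the conditional probability of \<open>B\<close> given \<open>s\<close> that serves all
parameters. Moving the data and the parameter by \<open>g\<close> changes neither the model nor \<open>B\<close>, so
\<open>k (s (g x))\<close> is a version as well: \<open>k \<circ> s\<close> is almost invariant. Smoothing makes it a function of
the maximal invariant of \<open>s\<close>.
\<close>

lemma conditional_probability_of_invariant_event:
  fixes P :: "'t \<Rightarrow> 'x measure" and s :: "'x \<Rightarrow> 's::topological_space"
    and actS :: "'g \<Rightarrow> 's \<Rightarrow> 's" and actT :: "'g \<Rightarrow> 't \<Rightarrow> 't"
  assumes model: "\<And>\<theta>. prob_space (P \<theta>)" "\<And>\<theta>. sets (P \<theta>) = sets borel"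
    and invariant: "invariant_model act actT P"
    and sufficient: "sufficient_statistic P borel s"
    and actS: "group_action_on actS" "continuous_action actS"
    and equivariant: "\<And>g x. s (act g x) = actS g (s x)"
    and mS: "maximal_invariant actS mS"
    and quasi: "\<And>g A. A \<in> null_sets (P \<theta>\<^sub>0) \<Longrightarrow> {x. act g x \<in> A} \<in> null_sets (P \<theta>\<^sub>0)"
    and B: "B \<in> sets borel" "\<And>g x. act g x \<in> B \<longleftrightarrow> x \<in> B"
  shows "\<exists>\<psi>\<in>borel_measurable (saturated_algebra (\<lambda>x. mS (s x))). (\<forall>x. 0 \<le> \<psi> x) \<and>
    (\<forall>\<theta>. absolutely_continuous (P \<theta>\<^sub>0) (P \<theta>) \<longrightarrow>
      (AE x in P \<theta>. real_cond_exp (P \<theta>) (vimage_algebra UNIV s borel) (indicator B) x = \<psi> x))"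
proof -
  let ?F = "vimage_algebra UNIV s (borel :: 's measure)"
  note [measurable_cong] = model(2)
  note [measurable] = B(1)
  have space_P: "space (P \<theta>) = UNIV" for \<theta> using sets_eq_imp_space_eq[OF model(2)[of \<theta>]] by simp
  have s [measurable]: "s \<in> borel_measurable borel"
    using sufficient by (simp add: sufficient_statistic_def)
  have sets_F: "sets ?F = {s -` D | D. D \<in> sets borel}"
    by (auto simp: sets_vimage_algebra2)
  have subalg: "subalgebra (P \<theta>) ?F" for \<theta>
    using measurable_sets[OF s] by (auto simp: subalgebra_def space_P sets_F model(2))
  interpret P: prob_space "P \<theta>" for \<theta> by (rule model)
  interpret C: finite_measure_subalgebra "P \<theta>" ?F for \<theta>
    by unfold_locales (rule subalg)
  have s_F: "s \<in> ?F \<rightarrow>\<^sub>M borel" by (rule measurable_vimage_algebra1) simp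
  have actS_meas: "actS g \<in> borel_measurable borel" for g
  proof -
    have "continuous_on UNIV (\<lambda>y. (g, y))" by (intro continuous_intros)
    from continuous_on_compose2[OF actS(2)[unfolded continuous_action_def] this]
    have "continuous_on UNIV (actS g)" by simp
    then show ?thesis by (rule borel_measurable_continuous_onI)
  qed
  obtain f where f [measurable]: "f \<in> borel_measurable borel"
    and cond_f: "\<And>\<theta>. AE x in P \<theta>. real_cond_exp (P \<theta>) ?F (indicator B) x = f (s x)"
    using sufficient B(1) unfolding sufficient_statistic_def by blast
  \<comment> \<open>Truncation to the unit interval keeps the version bounded everywhere.\<close>
  define k where "k y = max 0 (min 1 (f y))" for y
  have k_meas [measurable]: "k \<in> borel_measurable borel" unfolding k_def by measurable
  have k_s_F: "(\<lambda>x. k (s x)) \<in> borel_measurable ?F" by (rule measurable_compose[OF s_F k_meas])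
  have int_B: "integrable (P \<theta>) (indicator B :: 'x \<Rightarrow> real)" for \<theta>
    by (simp add: model(2) P.emeasure_finite less_top[symmetric])
  have cond_k: "AE x in P \<theta>. real_cond_exp (P \<theta>) ?F (indicator B) x = k (s x)" for \<theta>
  proof -
    have "AE x in P \<theta>. real_cond_exp (P \<theta>) ?F (indicator B) x \<ge> 0"
      by (rule C.real_cond_exp_pos) auto
    moreover have "AE x in P \<theta>. real_cond_exp (P \<theta>) ?F (indicator B) x \<le> 1"
      by (rule C.real_cond_exp_le_c[OF int_B]) (auto simp: indicator_def)
    ultimately show ?thesis using cond_f[of \<theta>]
      by eventually_elim (auto simp: k_def)
  qed
  have act_meas: "act g \<in> borel_measurable borel" for g by measurable
  have shift: "P (actT g \<theta>\<^sub>0) = distr (P \<theta>\<^sub>0) borel (act g)" for g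
    by (rule distr_action_invariant_model[OF invariant group model act_meas])
  have almost_invariant: "AE x in P \<theta>\<^sub>0. k (s (act g x)) = k (s x)" for g
  proof -
    have "AE x in P \<theta>\<^sub>0. real_cond_exp (P \<theta>\<^sub>0) ?F (indicator B) x = k (s (act g x))"
    proof (rule C.real_cond_exp_charact)
      show "(\<lambda>x. k (s (act g x))) \<in> borel_measurable ?F"
        using measurable_compose[OF s_F measurable_compose[OF actS_meas k_meas]]
        by (simp add: equivariant)
      show "integrable (P \<theta>\<^sub>0) (\<lambda>x. k (s (act g x)))"
        by (rule P.integrable_const_bound[where B=1]) (auto simp: k_def)
      fix A assume "A \<in> sets ?F"
      then obtain D where D [measurable]: "D \<in> sets borel" and A: "A = s -` D"
        by (auto simp: sets_F)
      \<comment> \<open>The translate of \<open>A\<close> is an event of the statistic because the group acts on its values.\<close>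
      define A' where "A' = s -` (actS (- g) -` D)"
      have "actS (- g) -` D \<in> sets borel" using measurable_sets[OF actS_meas D] by simp
      then have A'_F: "A' \<in> sets ?F" by (auto simp: A'_def sets_F)
      then have A'_borel [measurable]: "A' \<in> sets borel" using subalg model(2) unfolding subalgebra_def by blast
      have A_shift: "act g x \<in> A' \<longleftrightarrow> x \<in> A" for x
        using actS(1) unfolding A'_def A group_action_on_def by (auto simp: equivariant) (metis add.left_inverse)+
      have "(\<integral>x\<in>A. k (s (act g x)) \<partial>P \<theta>\<^sub>0) = (\<integral>x. indicator A' (act g x) * k (s (act g x)) \<partial>P \<theta>\<^sub>0)"
        unfolding set_lebesgue_integral_def by (rule Bochner_Integration.integral_cong) (auto simp: A_shift indicator_def)
      also have "\<dots> = (\<integral>y\<in>A'. k (s y) \<partial>P (actT g \<theta>\<^sub>0))"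
        unfolding shift set_lebesgue_integral_def by (subst integral_distr) auto
      also have "\<dots> = (\<integral>y\<in>A'. real_cond_exp (P (actT g \<theta>\<^sub>0)) ?F (indicator B) y \<partial>P (actT g \<theta>\<^sub>0))"
        unfolding set_lebesgue_integral_def
        by (rule integral_cong_AE) (use cond_k[of "actT g \<theta>\<^sub>0"] in auto)
      also have "\<dots> = (\<integral>y\<in>A'. indicator B y \<partial>P (actT g \<theta>\<^sub>0))"
        by (rule C.real_cond_exp_intA[symmetric]) (use A'_F int_B in auto)
      also have "\<dots> = (\<integral>x. indicator A' (act g x) * indicator B (act g x) \<partial>P \<theta>\<^sub>0)"
        unfolding shift set_lebesgue_integral_def by (subst integral_distr) auto
      also have "\<dots> = (\<integral>x\<in>A. indicator B x \<partial>P \<theta>\<^sub>0)"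
        unfolding set_lebesgue_integral_def
        by (rule Bochner_Integration.integral_cong) (auto simp: A_shift B(2) indicator_def)
      finally show "(\<integral>x\<in>A. indicator B x \<partial>P \<theta>\<^sub>0) = (\<integral>x\<in>A. k (s (act g x)) \<partial>P \<theta>\<^sub>0)" by simp
    qed (rule int_B)
    with cond_k[of \<theta>\<^sub>0] show ?thesis by eventually_elim simp
  qed
  have ks_meas: "(\<lambda>x. k (s x)) \<in> borel_measurable borel" by measurable
  have k_bounds: "0 \<le> k y" "k y \<le> 1" for y by (auto simp: k_def)
  obtain \<psi> where \<psi>: "\<psi> \<in> borel_measurable borel" "\<And>x. 0 \<le> \<psi> x" "AE x in P \<theta>\<^sub>0. \<psi> x = k (s x)"
      "\<And>x x' h. (\<forall>g. k (s (act g x)) = k (s (act (g + h) x'))) \<Longrightarrow> \<psi> x = \<psi> x'"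
    using smoothing_almost_invariant[OF model(1,2) quasi ks_meas k_bounds almost_invariant] by blast
  have "\<psi> x = \<psi> x'" if eq: "mS (s x) = mS (s x')" for x x'
  proof -
    obtain h where "s x = actS h (s x')" using mS eq unfolding maximal_invariant_def by blast
    then have "s (act g x) = s (act (g + h) x')" for g
      using actS(1) unfolding group_action_on_def by (simp add: equivariant)
    then show ?thesis by (intro \<psi>(4)[of _ h]) simp
  qed
  then have "\<psi> \<in> borel_measurable (saturated_algebra (\<lambda>x. mS (s x)))"
    by (rule measurable_saturated_algebra[OF \<psi>(1)])
  moreover have "AE x in P \<theta>. real_cond_exp (P \<theta>) ?F (indicator B) x = \<psi> x"
    if "absolutely_continuous (P \<theta>\<^sub>0) (P \<theta>)" for \<theta>
  proof -
    have "AE x in P \<theta>. \<psi> x = k (s x)"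
      by (rule absolutely_continuous_AE[OF _ that \<psi>(3)]) (simp add: model(2))
    with cond_k[of \<theta>] show ?thesis by eventually_elim simp
  qed
  ultimately show ?thesis using \<psi>(2) by blast
qed

end

section \<open>Equality of the two likelihood ratios\<close>

context free_proper_action
begin

text \<open>
Both ratios are invariant, so it suffices that they have the same integrals over invariant events
\<open>B\<close>. The ratio for \<open>mX\<close> integrates to \<open>Q B\<close>. For the other ratio \<open>R\<close>, let \<open>\<psi>\<close> be the
conditional probability of \<open>B\<close> given \<open>s\<close>, which is the same under \<open>P\<close> and \<open>Q\<close> and is a function
of \<open>mS \<circ> s\<close>. Then the expectation of \<open>\<psi>\<close> under \<open>Q\<close> is \<open>Q B\<close>, and it is also the expectation of
\<open>R \<psi>\<close> under \<open>P\<close>, which is the integral of \<open>R\<close> over \<open>B\<close>.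
\<close>

lemma likelihood_ratio_of_sufficient_maximal_invariant:
  fixes P :: "'t \<Rightarrow> 'x measure" and s :: "'x \<Rightarrow> 's::topological_space"
    and actS :: "'g \<Rightarrow> 's \<Rightarrow> 's" and actT :: "'g \<Rightarrow> 't \<Rightarrow> 't"
  assumes model: "\<And>\<theta>. prob_space (P \<theta>)" "\<And>\<theta>. sets (P \<theta>) = sets borel"
    and invariant: "invariant_model act actT P"
    and sufficient: "sufficient_statistic P borel s"
    and actS: "group_action_on actS" "continuous_action actS"
    and equivariant: "\<And>g x. s (act g x) = actS g (s x)"
    and quasi: "\<And>g A. A \<in> null_sets (P \<theta>\<^sub>0) \<Longrightarrow> {x. act g x \<in> A} \<in> null_sets (P \<theta>\<^sub>0)"
    and abs_cont: "absolutely_continuous (P \<theta>\<^sub>0) (P \<theta>\<^sub>1)"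
    and mX: "standard_borel \<nu>X" "mX \<in> borel \<rightarrow>\<^sub>M \<nu>X" "maximal_invariant act mX"
    and pMX: "\<And>y. 0 \<le> pMX y" "distributed (P \<theta>\<^sub>0) \<nu>X mX (\<lambda>y. ennreal (pMX y))"
    and qMX: "\<And>y. 0 \<le> qMX y" "distributed (P \<theta>\<^sub>1) \<nu>X mX (\<lambda>y. ennreal (qMX y))"
    and mS: "standard_borel \<nu>S" "mS \<in> borel \<rightarrow>\<^sub>M \<nu>S" "maximal_invariant actS mS"
    and pMS: "\<And>y. 0 \<le> pMS y" "distributed (P \<theta>\<^sub>0) \<nu>S (\<lambda>x. mS (s x)) (\<lambda>y. ennreal (pMS y))"
    and qMS: "\<And>y. 0 \<le> qMS y" "distributed (P \<theta>\<^sub>1) \<nu>S (\<lambda>x. mS (s x)) (\<lambda>y. ennreal (qMS y))"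
  shows "AE x in P \<theta>\<^sub>0. qMX (mX x) / pMX (mX x) = qMS (mS (s x)) / pMS (mS (s x))"
proof -
  let ?P = "P \<theta>\<^sub>0" and ?Q = "P \<theta>\<^sub>1" and ?F = "saturated_algebra mX"
    and ?S = "vimage_algebra UNIV s (borel :: 's measure)"
  define RX RS where "RX x = qMX (mX x) / pMX (mX x)"
    and "RS x = qMS (mS (s x)) / pMS (mS (s x))" for x
  have RX_nonneg: "0 \<le> RX x" and RS_nonneg: "0 \<le> RS x" for x
    using pMX(1) qMX(1) pMS(1) qMS(1) by (simp_all add: RX_def RS_def)
  note [measurable_cong] = model(2)
  have space_P: "space (P \<theta>) = UNIV" for \<theta> using sets_eq_imp_space_eq[OF model(2)[of \<theta>]] by simp
  have s [measurable]: "s \<in> borel_measurable borel"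
    using sufficient by (simp add: sufficient_statistic_def)
  have [measurable]: "mX \<in> borel \<rightarrow>\<^sub>M \<nu>X" "mS \<in> borel \<rightarrow>\<^sub>M \<nu>S" by fact+
  have [measurable]: "pMX \<in> borel_measurable \<nu>X" "qMX \<in> borel_measurable \<nu>X"
    "pMS \<in> borel_measurable \<nu>S" "qMS \<in> borel_measurable \<nu>S"
    using distributed_real_measurable[OF pMX(1) pMX(2)] distributed_real_measurable[OF qMX(1) qMX(2)]
      distributed_real_measurable[OF pMS(1) pMS(2)] distributed_real_measurable[OF qMS(1) qMS(2)] by simp_all
  have RX_meas [measurable]: "RX \<in> borel_measurable borel" unfolding RX_def by measurable
  have RS_meas [measurable]: "RS \<in> borel_measurable borel" unfolding RS_def by measurable
  have mS_s: "(\<lambda>x. mS (s x)) \<in> borel \<rightarrow>\<^sub>M \<nu>S" by measurable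
  have subalg: "subalgebra (P \<theta>) ?S" for \<theta>
    using measurable_sets[OF s] by (auto simp: subalgebra_def space_P sets_vimage_algebra2 model(2))
  interpret P: prob_space "P \<theta>" for \<theta> by (rule model)
  interpret C: finite_measure_subalgebra "P \<theta>" ?S for \<theta>
    by unfold_locales (rule subalg)
  have s_S: "s \<in> ?S \<rightarrow>\<^sub>M borel" by (rule measurable_vimage_algebra1) simp
  have RS_S: "RS \<in> borel_measurable ?S"
    unfolding RS_def by (rule measurable_compose[OF s_S]) measurable
  note LR_X = likelihood_ratio_on_saturated_algebra[OF P.finite_measure_axioms model(2,2) abs_cont mX(1,2) pMX qMX,
      folded RX_def]
  note LR_S = likelihood_ratio_on_saturated_algebra[OF P.finite_measure_axioms model(2,2) abs_cont mS(1) mS_s pMS qMS,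
      folded RS_def]
  have RS_int: "integrable ?P RS"
  proof (rule integrableI_nonneg)
    have "(\<integral>\<^sup>+x. ennreal (RS x) * 1 \<partial>?P) = (\<integral>\<^sup>+x. 1 \<partial>?Q)" by (rule LR_S[symmetric]) simp
    then show "(\<integral>\<^sup>+x. ennreal (RS x) \<partial>?P) < \<infinity>" by (simp add: P.emeasure_space_1)
  qed (auto simp: RS_nonneg)
  have invariant_set: "act g x \<in> B \<longleftrightarrow> x \<in> B" if "B \<in> sets ?F" for B g x
  proof -
    have "mX (act g x) = mX x" using mX(3) unfolding maximal_invariant_def by blast
    then show ?thesis using that unfolding sets_saturated_algebra
      by (metis (mono_tags, lifting) mem_Collect_eq)
  qed
  have key: "(\<integral>\<^sup>+x. ennreal (RX x) * indicator B x \<partial>?P) = (\<integral>\<^sup>+x. ennreal (RS x) * indicator B x \<partial>?P)"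
    if B: "B \<in> sets ?F" for B
  proof -
    have B_borel [measurable]: "B \<in> sets borel" using B unfolding sets_saturated_algebra by blast
    obtain \<psi> where \<psi>: "\<psi> \<in> borel_measurable (saturated_algebra (\<lambda>x. mS (s x)))" "\<And>x. 0 \<le> \<psi> x"
      "\<And>\<theta>. absolutely_continuous ?P (P \<theta>) \<Longrightarrow> AE x in P \<theta>. real_cond_exp (P \<theta>) ?S (indicator B) x = \<psi> x"
      using conditional_probability_of_invariant_event[OF model invariant sufficient actS equivariant
          mS(3) quasi B_borel invariant_set[OF B]] by blast
    have [measurable]: "\<psi> \<in> borel_measurable borel"
      by (rule measurable_from_subalg[OF _ \<psi>(1)]) (simp add: subalgebra_saturated_algebra)
    have int_B: "integrable (P \<theta>) (indicator B :: 'x \<Rightarrow> real)" for \<theta>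
      by (simp add: model(2) P.emeasure_finite less_top[symmetric])
    have RS_B: "integrable ?P (\<lambda>x. RS x * indicator B x)"
      using integrable_mult_indicator[OF _ RS_int, of B] by (simp add: model(2) mult.commute)
    have cond_P: "AE x in ?P. real_cond_exp ?P ?S (indicator B) x = \<psi> x"
      by (rule \<psi>(3)) (simp add: absolutely_continuous_def)
    note cond_Q = \<psi>(3)[OF abs_cont]
    have "(\<integral>\<^sup>+x. ennreal (RX x) * indicator B x \<partial>?P) = (\<integral>\<^sup>+x. indicator B x \<partial>?Q)"
      by (rule LR_X[symmetric]) (use B in measurable)
    also have "\<dots> = (\<integral>\<^sup>+x. ennreal (indicator B x) \<partial>?Q)" by (simp add: ennreal_indicator)
    also have "\<dots> = ennreal (\<integral>x. indicator B x \<partial>?Q)"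
      by (rule nn_integral_eq_integral[OF int_B]) simp
    also have "(\<integral>x. indicator B x \<partial>?Q) = (\<integral>x. real_cond_exp ?Q ?S (indicator B) x \<partial>?Q)"
      by (rule C.real_cond_exp_int(2)[OF int_B, symmetric])
    also have "\<dots> = (\<integral>x. \<psi> x \<partial>?Q)"
      by (rule integral_cong_AE) (use cond_Q in auto)
    also have "ennreal \<dots> = (\<integral>\<^sup>+x. ennreal (\<psi> x) \<partial>?Q)"
    proof (rule nn_integral_eq_integral[symmetric])
      show "integrable ?Q \<psi>"
        by (rule integrable_cong_AE_imp[OF C.real_cond_exp_int(1)[OF int_B]]) (use cond_Q in auto)
    qed (simp add: \<psi>(2))
    also have "\<dots> = (\<integral>\<^sup>+x. ennreal (RS x) * ennreal (\<psi> x) \<partial>?P)"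
      by (rule LR_S) (use \<psi>(1) in measurable)
    also have "\<dots> = (\<integral>\<^sup>+x. ennreal (RS x * \<psi> x) \<partial>?P)"
      by (simp add: ennreal_mult RS_nonneg \<psi>(2))
    also have "\<dots> = ennreal (\<integral>x. RS x * \<psi> x \<partial>?P)"
    proof (rule nn_integral_eq_integral)
      show "integrable ?P (\<lambda>x. RS x * \<psi> x)"
        by (rule integrable_cong_AE_imp[OF C.real_cond_exp_intg(1)[OF RS_B RS_S]])
           (use cond_P in auto)
    qed (simp add: RS_nonneg \<psi>(2))
    also have "(\<integral>x. RS x * \<psi> x \<partial>?P) = (\<integral>x. RS x * real_cond_exp ?P ?S (indicator B) x \<partial>?P)"
      by (rule integral_cong_AE) (use cond_P in auto)
    also have "\<dots> = (\<integral>x. RS x * indicator B x \<partial>?P)"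
      by (rule C.real_cond_exp_intg(2)[OF RS_B RS_S]) simp
    also have "ennreal \<dots> = (\<integral>\<^sup>+x. ennreal (RS x * indicator B x) \<partial>?P)"
      by (rule nn_integral_eq_integral[OF RS_B, symmetric]) (simp add: RS_nonneg)
    also have "\<dots> = (\<integral>\<^sup>+x. ennreal (RS x) * indicator B x \<partial>?P)"
      by (rule nn_integral_cong) (simp split: split_indicator)
    finally show ?thesis .
  qed
  note sub = subalgebra_saturated_algebra[OF model(2)[of \<theta>\<^sub>0], of mX]
  have RX_F: "RX \<in> borel_measurable ?F"
    by (rule measurable_saturated_algebra[OF RX_meas]) (simp add: RX_def)
  have RS_F: "RS \<in> borel_measurable ?F"
  proof (rule measurable_saturated_algebra[OF RS_meas])
    fix x x' assume "mX x = mX x'"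
    then obtain g where "x = act g x'" using mX(3) unfolding maximal_invariant_def by blast
    then have "mS (s x) = mS (s x')" using mS(3) unfolding maximal_invariant_def by (metis equivariant)
    then show "RS x = RS x'" by (simp add: RS_def)
  qed
  have "AE x in restr_to_subalg ?P ?F. ennreal (RX x) = ennreal (RS x)"
  proof (rule finite_measure.density_unique_finite_measure)
    show "finite_measure (restr_to_subalg ?P ?F)"
      by (rule finite_measure_restr_to_subalg[OF sub P.finite_measure_axioms])
    show "(\<lambda>x. ennreal (RX x)) \<in> borel_measurable (restr_to_subalg ?P ?F)"
      "(\<lambda>x. ennreal (RS x)) \<in> borel_measurable (restr_to_subalg ?P ?F)"
      using RX_F RS_F by (auto intro!: measurable_in_subalg[OF sub])
    fix B assume "B \<in> sets (restr_to_subalg ?P ?F)"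
    then have B [measurable]: "B \<in> sets ?F" by (simp add: sets_restr_to_subalg[OF sub])
    note [measurable] = RX_F RS_F
    show "(\<integral>\<^sup>+x. ennreal (RX x) * indicator B x \<partial>restr_to_subalg ?P ?F) =
        (\<integral>\<^sup>+x. ennreal (RS x) * indicator B x \<partial>restr_to_subalg ?P ?F)"
      using key[OF B] by (simp add: nn_integral_subalgebra2[OF sub])
  qed simp_all
  then have "AE x in ?P. ennreal (RX x) = ennreal (RS x)" by (rule AE_restr_to_subalg[OF sub])
  then show ?thesis
    by eventually_elim (use RX_nonneg RS_nonneg in \<open>simp add: RX_def RS_def\<close>)
qed

end

section \<open>Asymptotically invariant averages\<close>

text \<open>
Setwise asymptotic invariance extends to bounded integrands, because these are uniform limits of
functions with finitely many values.
\<close>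

lemma asymptotically_invariant_integral:
  fixes D :: "nat \<Rightarrow> 'g::topological_group_add measure" and F :: "'g \<Rightarrow> real"
  assumes D: "\<And>k. prob_space (D k)" "\<And>k. sets (D k) = sets borel"
    and asymptotic: "\<And>B. B \<in> sets borel \<Longrightarrow>
      (\<lambda>k. \<bar>measure (D k) B - measure (D k) ((\<lambda>h. h + g) ` B)\<bar>) \<longlonglongrightarrow> 0"
    and F [measurable]: "F \<in> borel_measurable borel" and bound: "\<And>h. \<bar>F h\<bar> \<le> c"
  shows "(\<lambda>k. (\<integral>h. F (h + g) \<partial>D k) - (\<integral>h. F h \<partial>D k)) \<longlonglongrightarrow> 0"
proof (rule LIMSEQ_I)
  fix e :: real assume "0 < e"
  interpret D: prob_space "D k" for k by (rule D)
  note [measurable_cong] = D(2)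
  have space_D: "space (D k) = UNIV" for k using sets_eq_imp_space_eq[OF D(2)[of k]] by simp
  have "continuous_on UNIV (\<lambda>h. h + g)" by (intro continuous_intros)
  then have shift [measurable]: "(\<lambda>h. h + g) \<in> borel_measurable borel"
    by (rule borel_measurable_continuous_onI)
  obtain n :: nat where n: "3 / e < real n" using reals_Archimedean2 by blast
  then have "0 < real n" using \<open>0 < e\<close> by (meson divide_pos_pos less_trans zero_less_numeral)
  \<comment> \<open>\<open>G\<close> is \<open>F\<close> rounded down to a multiple of \<open>1 / n\<close>.\<close>
  define J where "J = {\<lfloor>- (n * c)\<rfloor>..\<lfloor>n * c\<rfloor>}"
  define A where "A i = {h. \<lfloor>n * F h\<rfloor> = i}" for i
  define G where "G h = (\<Sum>i\<in>J. of_int i / n * indicator (A i) h)" for h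
  have A [measurable]: "A i \<in> sets borel" for i unfolding A_def by measurable
  have A_shift [measurable]: "{h. h + g \<in> A i} \<in> sets borel" for i by measurable
  have G_eq: "G h = of_int \<lfloor>n * F h\<rfloor> / n" for h
  proof -
    have "- c \<le> F h" "F h \<le> c" using bound[of h] by linarith+
    then have "n * F h \<le> n * c" "- (n * c) \<le> n * F h"
      using \<open>0 < real n\<close> mult_left_mono[of "- c" "F h" "real n"] by (auto intro: mult_left_mono)
    then have "\<lfloor>n * F h\<rfloor> \<in> J" unfolding J_def by (auto intro: floor_mono)
    moreover have "G h = (\<Sum>i\<in>J. if i = \<lfloor>n * F h\<rfloor> then of_int \<lfloor>n * F h\<rfloor> / n else 0)"
      unfolding G_def by (rule sum.cong) (auto simp: A_def)
    ultimately show ?thesis by (simp add: J_def)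
  qed
  have G_F: "\<bar>F h - G h\<bar> \<le> 1 / n" for h
  proof -
    have "\<bar>n * F h - of_int \<lfloor>n * F h\<rfloor>\<bar> \<le> 1" by linarith
    moreover have "F h - G h = (n * F h - of_int \<lfloor>n * F h\<rfloor>) / n"
      using \<open>0 < real n\<close> by (simp add: G_eq diff_divide_distrib)
    ultimately show ?thesis using \<open>0 < real n\<close> by (simp add: divide_right_mono)
  qed
  have F_int: "integrable (D k) F" "integrable (D k) (\<lambda>h. F (h + g))" for k
    using bound by (auto intro!: D.integrable_const_bound[where B=c])
  have ind_int: "integrable (D k) (indicator (A i) :: _ \<Rightarrow> real)"
    "integrable (D k) (\<lambda>h. indicator (A i) (h + g) :: real)" for k i
    by (auto intro!: D.integrable_const_bound[where B=1] simp: indicator_def)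
  have G_int: "integrable (D k) G" "integrable (D k) (\<lambda>h. G (h + g))" for k
    unfolding G_def using ind_int by auto
  have approx: "\<bar>(\<integral>h. F h \<partial>D k) - (\<integral>h. G h \<partial>D k)\<bar> \<le> 1 / n"
    "\<bar>(\<integral>h. F (h + g) \<partial>D k) - (\<integral>h. G (h + g) \<partial>D k)\<bar> \<le> 1 / n" for k
  proof -
    have "\<bar>\<integral>h. F h - G h \<partial>D k\<bar> \<le> (\<integral>h. 1 / n \<partial>D k)"
      by (rule order_trans[OF integral_abs_bound integral_mono])
         (use F_int G_int G_F in \<open>auto intro!: integrable_abs Bochner_Integration.integrable_diff\<close>)
    then show "\<bar>(\<integral>h. F h \<partial>D k) - (\<integral>h. G h \<partial>D k)\<bar> \<le> 1 / n"
      using F_int G_int by (simp add: D.prob_space)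
    have "\<bar>\<integral>h. F (h + g) - G (h + g) \<partial>D k\<bar> \<le> (\<integral>h. 1 / n \<partial>D k)"
      by (rule order_trans[OF integral_abs_bound integral_mono])
         (use F_int G_int G_F in \<open>auto intro!: integrable_abs Bochner_Integration.integrable_diff\<close>)
    then show "\<bar>(\<integral>h. F (h + g) \<partial>D k) - (\<integral>h. G (h + g) \<partial>D k)\<bar> \<le> 1 / n"
      using F_int G_int by (simp add: D.prob_space)
  qed
  have "(\<lambda>k. measure (D k) {h. h + g \<in> A i} - measure (D k) (A i)) \<longlonglongrightarrow> 0" for i
  proof -
    have "(\<lambda>h. h + g) ` {h. h + g \<in> A i} = A i"
      by (auto simp: image_iff intro!: exI[of _ "_ - g"])
    then show ?thesis using asymptotic[OF A_shift[of i]] by (simp add: tendsto_rabs_zero_iff)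
  qed
  then have "(\<lambda>k. \<Sum>i\<in>J. of_int i / n * (measure (D k) {h. h + g \<in> A i} - measure (D k) (A i))) \<longlonglongrightarrow> 0"
    by (intro tendsto_null_sum tendsto_mult_right_zero)
  moreover have "(\<integral>h. G (h + g) \<partial>D k) - (\<integral>h. G h \<partial>D k) =
      (\<Sum>i\<in>J. of_int i / n * (measure (D k) {h. h + g \<in> A i} - measure (D k) (A i)))" for k
  proof -
    have "(\<integral>h. indicat_real (A i) (h + g) \<partial>D k) = measure (D k) {h. h + g \<in> A i}" for i
    proof -
      have "(\<integral>h. indicat_real (A i) (h + g) \<partial>D k) = (\<integral>h. indicat_real {h. h + g \<in> A i} h \<partial>D k)"
        by (rule Bochner_Integration.integral_cong) (auto simp: indicator_def)
      then show ?thesis by (simp add: space_D)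
    qed
    then show ?thesis
      unfolding G_def using ind_int by (simp add: sum_subtractf right_diff_distrib space_D)
  qed
  ultimately have "(\<lambda>k. (\<integral>h. G (h + g) \<partial>D k) - (\<integral>h. G h \<partial>D k)) \<longlonglongrightarrow> 0" by simp
  then obtain k0 where k0: "\<And>k. k \<ge> k0 \<Longrightarrow> \<bar>(\<integral>h. G (h + g) \<partial>D k) - (\<integral>h. G h \<partial>D k)\<bar> < 1 / n"
    using LIMSEQ_D[of _ 0 "1 / n"] \<open>0 < real n\<close> by (metis (no_types, lifting) diff_zero divide_pos_pos real_norm_def zero_less_one)
  have "3 / n < e" using n \<open>0 < e\<close> \<open>0 < real n\<close> by (simp add: field_simps)
  then have "norm ((\<integral>h. F (h + g) \<partial>D k) - (\<integral>h. F h \<partial>D k) - 0) < e" if "k \<ge> k0" for k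
    using k0[OF that] approx[of k] by (simp add: abs_if split: if_splits)
  then show "\<exists>k0. \<forall>k\<ge>k0. norm ((\<integral>h. F (h + g) \<partial>D k) - (\<integral>h. F h \<partial>D k) - 0) < e" by blast
qed

section \<open>Expected logarithms\<close>

lemma measurable_ext_ln [measurable]: "ext_ln \<in> borel_measurable borel"
  unfolding ext_ln_def by measurable

lemma e2ennreal_ext_ln: "e2ennreal (ext_ln t) = ennreal (ln (max 1 t))"
proof (cases "0 < t")
  case True
  then show ?thesis by (cases "1 \<le> t") (auto simp: ext_ln_def e2ennreal_ereal ennreal_neg max_def)
qed (simp add: ext_ln_def e2ennreal_neg)

text \<open>
From \<open>ln t = ln N + ln (t / N)\<close>: a bound for the part of the logarithm above \<open>ln N\<close> bounds the
whole positive part.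
\<close>

lemma nn_integral_positive_log_le:
  assumes Q: "prob_space Q" and T [measurable]: "T \<in> borel_measurable Q"
    and "1 \<le> N" "0 \<le> \<eta>" and excess: "(\<integral>\<^sup>+x. ennreal (ln (max 1 (T x / N))) \<partial>Q) \<le> ennreal \<eta>"
  shows "(\<integral>\<^sup>+x. e2ennreal (ext_ln (T x)) \<partial>Q) \<le> ennreal (ln N + \<eta>)"
proof -
  interpret Q: prob_space Q by fact
  have "(\<integral>\<^sup>+x. e2ennreal (ext_ln (T x)) \<partial>Q) \<le> (\<integral>\<^sup>+x. ennreal (ln N) + ennreal (ln (max 1 (T x / N))) \<partial>Q)"
    unfolding e2ennreal_ext_ln
  proof (rule nn_integral_mono)
    fix x
    have "max 1 (T x) \<le> N * max 1 (T x / N)"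
      using \<open>1 \<le> N\<close> by (auto simp: max_def field_simps)
    then have "ln (max 1 (T x)) \<le> ln (N * max 1 (T x / N))" by simp
    also have "\<dots> = ln N + ln (max 1 (T x / N))" using \<open>1 \<le> N\<close> by (intro ln_mult_pos) auto
    finally have "ennreal (ln (max 1 (T x))) \<le> ennreal (ln N + ln (max 1 (T x / N)))"
      by (rule ennreal_leI)
    then show "ennreal (ln (max 1 (T x))) \<le> ennreal (ln N) + ennreal (ln (max 1 (T x / N)))"
      using \<open>1 \<le> N\<close> by simp
  qed
  also have "\<dots> = ennreal (ln N) + (\<integral>\<^sup>+x. ennreal (ln (max 1 (T x / N))) \<partial>Q)"
    by (subst nn_integral_add) (auto simp: Q.emeasure_space_1)
  also have "\<dots> \<le> ennreal (ln N) + ennreal \<eta>" by (intro add_left_mono excess)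
  also have "\<dots> = ennreal (ln N + \<eta>)" using \<open>1 \<le> N\<close> \<open>0 \<le> \<eta>\<close> by simp
  finally show ?thesis .
qed

lemma ext_expectation_ln_eq_integral:
  assumes "AE x in M. 0 < T x" and int: "integrable M (\<lambda>x. ln (T x))"
  shows "ext_expectation M (\<lambda>x. ext_ln (T x)) = ereal (\<integral>x. ln (T x) \<partial>M)"
proof -
  have "(\<integral>\<^sup>+x. e2ennreal (ext_ln (T x)) \<partial>M) = (\<integral>\<^sup>+x. ennreal (ln (T x)) \<partial>M)"
    by (rule nn_integral_cong_AE) (use assms(1) in \<open>auto simp: ext_ln_def e2ennreal_ereal\<close>)
  moreover have "(\<integral>\<^sup>+x. e2ennreal (- ext_ln (T x)) \<partial>M) = (\<integral>\<^sup>+x. ennreal (- ln (T x)) \<partial>M)"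
    by (rule nn_integral_cong_AE) (use assms(1) in \<open>auto simp: ext_ln_def e2ennreal_ereal\<close>)
  moreover have fin: "(\<integral>\<^sup>+x. ennreal (ln (T x)) \<partial>M) < \<infinity>" "(\<integral>\<^sup>+x. ennreal (- ln (T x)) \<partial>M) < \<infinity>"
    using int unfolding real_integrable_def by (simp_all add: less_top)
  moreover have "ereal (\<integral>x. ln (T x) \<partial>M) =
      enn2ereal (\<integral>\<^sup>+x. ennreal (ln (T x)) \<partial>M) - enn2ereal (\<integral>\<^sup>+x. ennreal (- ln (T x)) \<partial>M)"
    unfolding real_lebesgue_integral_def[OF int] using fin
    by (cases "\<integral>\<^sup>+x. ennreal (ln (T x)) \<partial>M"; cases "\<integral>\<^sup>+x. ennreal (- ln (T x)) \<partial>M") auto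
  ultimately show ?thesis unfolding ext_expectation_def by (simp add: Let_def less_top[symmetric])
qed

lemma integrable_ln_if_ext_expectation:
  assumes T [measurable]: "T \<in> borel_measurable M"
    and pos: "(\<integral>\<^sup>+x. e2ennreal (ext_ln (T x)) \<partial>M) < \<infinity>"
    and ext: "- \<infinity> < ext_expectation M (\<lambda>x. ext_ln (T x))"
  shows "AE x in M. 0 < T x" "integrable M (\<lambda>x. ln (T x))"
proof -
  have neg: "(\<integral>\<^sup>+x. e2ennreal (- ext_ln (T x)) \<partial>M) \<noteq> \<infinity>"
    using ext unfolding ext_expectation_def by (auto simp: Let_def split: if_splits)
  have "AE x in M. e2ennreal (- ext_ln (T x)) \<noteq> \<infinity>"
    by (rule nn_integral_PInf_AE[OF _ neg]) measurable
  then show T_pos: "AE x in M. 0 < T x"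
    by eventually_elim (auto simp: ext_ln_def not_le[symmetric] e2ennreal_infty split: if_splits)
  have "(\<integral>\<^sup>+x. ennreal (- ln (T x)) \<partial>M) = (\<integral>\<^sup>+x. e2ennreal (- ext_ln (T x)) \<partial>M)"
    by (rule nn_integral_cong_AE) (use T_pos in \<open>auto simp: ext_ln_def e2ennreal_ereal\<close>)
  moreover have "(\<integral>\<^sup>+x. ennreal (ln (T x)) \<partial>M) = (\<integral>\<^sup>+x. e2ennreal (ext_ln (T x)) \<partial>M)"
    by (rule nn_integral_cong_AE) (use T_pos in \<open>auto simp: ext_ln_def e2ennreal_ereal\<close>)
  ultimately show "integrable M (\<lambda>x. ln (T x))"
    using neg pos by (auto simp: real_integrable_def)
qed

text \<open>
The bound that permits truncating e-statistics from above, uniformly over all of them. Where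
\<open>T > N\<close>, write \<open>ln (T / N) = ln r + ln w\<close> with \<open>w = T / (N * r)\<close> and \<open>ln w \<le> w\<close>, where \<open>w\<close> has
expectation at most \<open>1 / N\<close> under \<open>Q\<close>. The term \<open>ln r\<close> is either large, which happens only on
a tail that does not involve \<open>T\<close>, or at most \<open>C\<close>, and then \<open>1 \<le> exp C * w\<close>.
\<close>

lemma uniformly_small_log_excess:
  assumes r: "r \<in> borel_measurable P" "AE x in Q. 0 < r x"
    and Q: "prob_space Q" "Q = density P (\<lambda>x. ennreal (r x))"
    and int: "integrable Q (\<lambda>x. ln (r x))" and "0 < \<eta>"
  shows "\<exists>N\<ge>1. \<forall>T\<in>borel_measurable P. (\<forall>x. 0 \<le> T x) \<longrightarrow> (\<integral>\<^sup>+x. ennreal (T x) \<partial>P) \<le> 1 \<longrightarrow>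
    (\<integral>\<^sup>+x. ennreal (ln (max 1 (T x / N))) \<partial>Q) \<le> ennreal \<eta>"
proof -
  interpret Q: prob_space Q by fact
  have sets_Q [measurable_cong]: "sets Q = sets P" by (simp add: Q(2))
  note [measurable] = r(1)
  define \<tau> where "\<tau> C = (\<integral>x. (if C < \<bar>ln (r x)\<bar> then \<bar>ln (r x)\<bar> else 0) \<partial>Q)" for C :: real
  have \<tau>_int: "integrable Q (\<lambda>x. if C < \<bar>ln (r x)\<bar> then \<bar>ln (r x)\<bar> else 0)" for C
    by (rule Bochner_Integration.integrable_bound[OF int]) auto
  have "(\<lambda>n. \<tau> (real n)) \<longlonglongrightarrow> (\<integral>x. 0 \<partial>Q)"
    unfolding \<tau>_def
  proof (rule integral_dominated_convergence)
    show "integrable Q (\<lambda>x. \<bar>ln (r x)\<bar>)" using int by simp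
    show "AE x in Q. (\<lambda>n. if real n < \<bar>ln (r x)\<bar> then \<bar>ln (r x)\<bar> else 0) \<longlonglongrightarrow> 0"
    proof (rule AE_I2)
      fix x
      obtain n0 :: nat where "\<bar>ln (r x)\<bar> \<le> real n0" using real_arch_simple by blast
      then have "eventually (\<lambda>n. (if real n < \<bar>ln (r x)\<bar> then \<bar>ln (r x)\<bar> else 0) = 0) sequentially"
        by (intro eventually_sequentiallyI[of n0]) (auto simp: not_less)
      then show "(\<lambda>n. if real n < \<bar>ln (r x)\<bar> then \<bar>ln (r x)\<bar> else 0) \<longlonglongrightarrow> 0"
        by (rule tendsto_eventually)
    qed
  qed auto
  then have "eventually (\<lambda>n. \<tau> (real n) < \<eta> / 2) sequentially"
    using \<open>0 < \<eta>\<close> by (intro order_tendstoD(2)[where y=0]) auto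
  then obtain C :: nat where C: "\<tau> (real C) < \<eta> / 2" by (auto simp: eventually_sequentially)
  \<comment> \<open>Outside the tail the excess is at most \<open>K * w\<close>, whose expectation is at most \<open>K / N\<close>.\<close>
  define K where "K = C * exp (real C) + 1"
  define N where "N = max 1 (2 * K / \<eta>)"
  have K: "0 < K" by (simp add: K_def add_nonneg_pos)
  have N: "1 \<le> N" "K / N \<le> \<eta> / 2"
    using \<open>0 < \<eta>\<close> K by (auto simp: N_def field_simps max_def)
  have "(\<integral>\<^sup>+x. ennreal (ln (max 1 (T x / N))) \<partial>Q) \<le> ennreal \<eta>"
    if T [measurable]: "T \<in> borel_measurable P" and T_nonneg: "\<And>x. 0 \<le> T x"
      and T_int: "(\<integral>\<^sup>+x. ennreal (T x) \<partial>P) \<le> 1" for T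
  proof -
    have pointwise: "ln (max 1 (T x / N)) \<le>
        (if C < \<bar>ln (r x)\<bar> then \<bar>ln (r x)\<bar> else 0) + K / N * (T x / r x)" if "0 < r x" for x
    proof (cases "T x \<le> N")
      case True
      then have "max 1 (T x / N) = 1" using N(1) by (simp add: field_simps)
      moreover have "0 \<le> K / N * (T x / r x)" using K N(1) T_nonneg[of x] that by simp
      ultimately show ?thesis by simp
    next
      case False
      have N_pos: "0 < N" using N(1) by simp
      have u: "1 < T x / N" using False N_pos by (simp add: field_simps)
      define w where "w = T x / N / r x"
      have w: "0 < w" using less_trans[OF zero_less_one u] that unfolding w_def by (rule divide_pos_pos)
      have "T x / N = r x * w" using that by (simp add: w_def)
      then have "ln (T x / N) = ln (r x) + ln w"
        using that w by (simp add: ln_mult)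
      also have "ln w \<le> w" using ln_le_minus_one[OF w] by simp
      finally have bound: "ln (T x / N) \<le> ln (r x) + w" by simp
      have "ln (r x) \<le> (if C < \<bar>ln (r x)\<bar> then \<bar>ln (r x)\<bar> else 0) + C * exp (real C) * w"
      proof (cases "real C < \<bar>ln (r x)\<bar>")
        case True
        moreover have "0 \<le> real C * exp (real C) * w" using w by simp
        ultimately show ?thesis using abs_ge_self[of "ln (r x)"] by simp
      next
        case False
        then have ln_C: "ln (r x) \<le> C" by simp
        then have "r x \<le> exp C" using that by (metis exp_le_cancel_iff exp_ln)
        then have "1 \<le> exp (real C) / r x" using that by simp
        also have "\<dots> \<le> exp (real C) * w"
        proof -
          have "exp (real C) / r x * 1 \<le> exp (real C) / r x * (T x / N)"
            using u that by (intro mult_left_mono) auto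
          then show ?thesis by (simp add: w_def mult.commute)
        qed
        finally have "real C * 1 \<le> real C * (exp (real C) * w)" by (intro mult_left_mono) auto
        then show ?thesis using ln_C False by (simp add: mult.assoc)
      qed
      moreover have "K / N * (T x / r x) = C * exp (real C) * w + w"
        by (simp add: K_def w_def algebra_simps add_divide_distrib)
      ultimately show ?thesis using bound u by (simp add: max_def)
    qed
    have T_r: "(\<integral>\<^sup>+x. ennreal (T x / r x) \<partial>Q) \<le> 1"
    proof -
      have "(\<integral>\<^sup>+x. ennreal (T x / r x) \<partial>Q) = (\<integral>\<^sup>+x. ennreal (r x) * ennreal (T x / r x) \<partial>P)"
        unfolding Q(2) by (rule nn_integral_density) auto
      also have "\<dots> \<le> (\<integral>\<^sup>+x. ennreal (T x) \<partial>P)"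
      proof (rule nn_integral_mono)
        fix x
        show "ennreal (r x) * ennreal (T x / r x) \<le> ennreal (T x)"
          using T_nonneg[of x] by (cases "0 < r x") (auto simp: ennreal_mult[symmetric] ennreal_neg)
      qed
      finally show ?thesis using T_int by simp
    qed
    have "(\<integral>\<^sup>+x. ennreal (ln (max 1 (T x / N))) \<partial>Q) \<le>
        (\<integral>\<^sup>+x. ennreal (if C < \<bar>ln (r x)\<bar> then \<bar>ln (r x)\<bar> else 0) + ennreal (K / N) * ennreal (T x / r x) \<partial>Q)"
      by (rule nn_integral_mono_AE) (use r(2) in eventually_elim,
        use pointwise K N(1) T_nonneg in \<open>simp add: ennreal_mult[symmetric] ennreal_plus[symmetric] del: ennreal_plus\<close>)
    also have "\<dots> = ennreal (\<tau> C) + ennreal (K / N) * (\<integral>\<^sup>+x. ennreal (T x / r x) \<partial>Q)"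
      unfolding \<tau>_def by (subst nn_integral_add) (auto simp: nn_integral_cmult nn_integral_eq_integral[OF \<tau>_int])
    also have "\<dots> \<le> ennreal (\<tau> C) + ennreal (K / N) * 1"
      by (intro add_left_mono mult_left_mono T_r) auto
    also have "\<dots> \<le> ennreal (\<eta> / 2) + ennreal (\<eta> / 2)"
      using C N(2) by (simp only: mult_1_right) (intro add_mono ennreal_leI, simp_all)
    also have "\<dots> = ennreal \<eta>" using \<open>0 < \<eta>\<close> by (simp flip: ennreal_plus)
    finally show ?thesis .
  qed
  then show ?thesis using N(1) by blast
qed

section \<open>The bound on worst-case growth\<close>

context free_proper_action
begin

text \<open>
Let \<open>L k x\<close> be the average of \<open>ln (T (h x))\<close> over \<open>h\<close> drawn from the \<open>k\<close>-th averaging law. By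
Jensen's inequality \<open>exp (L k)\<close> has expectation at most 1 under \<open>P\<close>, and the expectation of
\<open>L k\<close> under \<open>Q\<close> is at least \<open>v\<close>. Amenability makes \<open>L k\<close> asymptotically constant on every orbit:
\<open>L k x\<close> differs from \<open>L' k x\<close>, its value at the representative of the orbit, by a quantity that
vanishes for every \<open>x\<close>. The function \<open>L' k\<close> is exactly invariant, and Gibbs' inequality
\<open>ln (exp l / R) \<le> exp l / R - 1\<close> for \<open>l = L' k x\<close> bounds its expectation under \<open>Q\<close> by that of
\<open>ln R\<close>, plus the excess over 1 of the expectation of \<open>exp (L' k)\<close> under \<open>P\<close>. Since everything is
bounded, dominated convergence lets \<open>k\<close> tend to infinity.
\<close>

lemma bounded_growth_bound:
  fixes P Q :: "'x measure" and mX :: "'x \<Rightarrow> 'm" and R T :: "'x \<Rightarrow> real"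
    and D :: "nat \<Rightarrow> 'g measure"
  assumes P: "prob_space P" "sets P = sets borel" and Q: "prob_space Q" "sets Q = sets borel"
    and mX: "maximal_invariant act mX"
    and R: "R \<in> borel_measurable (saturated_algebra mX)" "AE x in Q. 0 < R x"
      "integrable Q (\<lambda>x. ln (R x))"
    and LR: "\<And>h. h \<in> borel_measurable (saturated_algebra mX) \<Longrightarrow>
      (\<integral>\<^sup>+x. h x \<partial>Q) = (\<integral>\<^sup>+x. ennreal (R x) * h x \<partial>P)"
    and D: "\<And>k. prob_space (D k)" "\<And>k. sets (D k) = sets borel"
    and asymptotic: "\<And>B g. B \<in> sets borel \<Longrightarrow>
      (\<lambda>k. \<bar>measure (D k) B - measure (D k) ((\<lambda>h. h + g) ` B)\<bar>) \<longlonglongrightarrow> 0"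
    and T: "T \<in> borel_measurable borel" "0 < c" "\<And>x. c \<le> T x" "\<And>x. T x \<le> N"
    and null: "\<And>g. (\<integral>\<^sup>+x. ennreal (T (act g x)) \<partial>P) \<le> 1"
    and growth: "\<And>g. v \<le> (\<integral>x. ln (T (act g x)) \<partial>Q)"
  shows "v \<le> (\<integral>x. ln (R x) \<partial>Q)"
proof -
  interpret P: prob_space P by fact
  interpret Q: prob_space Q by fact
  interpret D: prob_space "D k" for k by (rule D)
  interpret PD: pair_sigma_finite P "D k" for k ..
  interpret QD: pair_sigma_finite Q "D k" for k ..
  note [measurable_cong] = P(2) Q(2) D(2)
  note [measurable] = T(1)
  have R_meas [measurable]: "R \<in> borel_measurable borel"
    by (rule measurable_from_subalg[OF _ R(1)]) (simp add: subalgebra_saturated_algebra)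
  have T_pos: "0 < T x" for x using T(2) T(3)[of x] by simp
  define b where "b = max \<bar>ln c\<bar> \<bar>ln N\<bar>"
  have b: "\<bar>ln (T x)\<bar> \<le> b" for x
  proof -
    have "ln c \<le> ln (T x)" "ln (T x) \<le> ln N"
      using T(2) T(3)[of x] T(4)[of x] T_pos[of x] by auto
    then show ?thesis unfolding b_def by linarith
  qed
  define L where "L k x = (\<integral>h. ln (T (act h x)) \<partial>D k)" for k x
  define L' where "L' k x = L k (orbit_rep x)" for k x
  have L_meas [measurable]: "L k \<in> borel_measurable borel" for k
    unfolding L_def by measurable
  have L'_meas [measurable]: "L' k \<in> borel_measurable borel" for k
    unfolding L'_def by measurable
  have ln_int: "integrable (D k) (\<lambda>h. ln (T (act h x)))" for k x
    by (rule D.integrable_const_bound[where B=b]) (use b in auto)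
  have L_bound: "\<bar>L k x\<bar> \<le> b" for k x
  proof -
    have "\<bar>L k x\<bar> \<le> (\<integral>h. b \<partial>D k)"
      unfolding L_def by (rule order_trans[OF integral_abs_bound integral_mono]) (use b ln_int in auto)
    then show ?thesis by (simp add: D.prob_space)
  qed
  have L'_bound: "\<bar>L' k x\<bar> \<le> b" for k x unfolding L'_def by (rule L_bound)
  have L_L': "(\<lambda>k. L k x - L' k x) \<longlonglongrightarrow> 0" for x
  proof -
    let ?F = "\<lambda>h. ln (T (act h (orbit_rep x)))"
    have "(\<lambda>k. (\<integral>h. ?F (h + displacement x) \<partial>D k) - (\<integral>h. ?F h \<partial>D k)) \<longlonglongrightarrow> 0"
    proof (rule asymptotically_invariant_integral[where c=b, OF D asymptotic _ b])
      show "?F \<in> borel_measurable borel" by measurable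
    qed
    then show ?thesis by (simp add: L_def L'_def act_add)
  qed
  have exp_bound: "exp y \<le> exp b" if "\<bar>y\<bar> \<le> b" for y :: real using that by simp
  have L_int: "integrable Q (L k)" "integrable Q (L' k)" for k
    using L_bound L'_bound by (auto intro!: Q.integrable_const_bound[where B=b])
  have exp_int: "integrable P (\<lambda>x. exp (L k x))" "integrable P (\<lambda>x. exp (L' k x))" for k
    using exp_bound[OF L_bound] exp_bound[OF L'_bound]
    by (auto intro!: P.integrable_const_bound[where B="exp b"])
  have conv_Q: "(\<lambda>k. (\<integral>x. L k x \<partial>Q) - (\<integral>x. L' k x \<partial>Q)) \<longlonglongrightarrow> 0"
  proof -
    have "(\<lambda>k. \<integral>x. L k x - L' k x \<partial>Q) \<longlonglongrightarrow> (\<integral>x. 0 \<partial>Q)"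
    proof (rule integral_dominated_convergence[where w="\<lambda>_. 2 * b"])
      fix k show "AE x in Q. norm (L k x - L' k x) \<le> 2 * b"
      proof (rule AE_I2)
        fix x show "norm (L k x - L' k x) \<le> 2 * b"
          using L_bound[of k x] L'_bound[of k x] unfolding real_norm_def by linarith
      qed
    qed (use L_L' in auto)
    then show ?thesis using L_int by simp
  qed
  have conv_P: "(\<lambda>k. (\<integral>x. exp (L' k x) \<partial>P) - (\<integral>x. exp (L k x) \<partial>P)) \<longlonglongrightarrow> 0"
  proof -
    have "(\<lambda>k. \<integral>x. exp (L' k x) - exp (L k x) \<partial>P) \<longlonglongrightarrow> (\<integral>x. 0 \<partial>P)"
    proof (rule integral_dominated_convergence[where w="\<lambda>_. exp b"])
      fix k show "AE x in P. norm (exp (L' k x) - exp (L k x)) \<le> exp b"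
      proof (rule AE_I2)
        fix x
        show "norm (exp (L' k x) - exp (L k x)) \<le> exp b"
          using exp_bound[OF L_bound[of k x]] exp_bound[OF L'_bound[of k x]]
            exp_gt_zero[of "L k x"] exp_gt_zero[of "L' k x"] unfolding real_norm_def by linarith
      qed
    next
      show "AE x in P. (\<lambda>k. exp (L' k x) - exp (L k x)) \<longlonglongrightarrow> 0"
      proof (rule AE_I2)
        fix x
        have "(\<lambda>k. exp b * \<bar>exp (L k x - L' k x) - 1\<bar>) \<longlonglongrightarrow> exp b * \<bar>exp 0 - 1\<bar>"
          by (intro tendsto_intros L_L')
        moreover have "\<bar>exp (L' k x) - exp (L k x)\<bar> \<le> exp b * \<bar>exp (L k x - L' k x) - 1\<bar>" for k
        proof -
          have "exp (L k x) - exp (L' k x) = exp (L' k x) * (exp (L k x - L' k x) - 1)"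
            by (simp add: exp_diff field_simps)
          then have "\<bar>exp (L' k x) - exp (L k x)\<bar> = exp (L' k x) * \<bar>exp (L k x - L' k x) - 1\<bar>"
            by (metis abs_exp_cancel abs_minus_commute abs_mult)
          then show ?thesis using exp_bound[OF L'_bound[of k x]] by (simp add: mult_right_mono)
        qed
        ultimately have "eventually (\<lambda>k. norm (exp (L' k x) - exp (L k x)) \<le>
            exp b * \<bar>exp (L k x - L' k x) - 1\<bar>) sequentially"
          and "(\<lambda>k. exp b * \<bar>exp (L k x - L' k x) - 1\<bar>) \<longlonglongrightarrow> 0" by simp_all
        then show "(\<lambda>k. exp (L' k x) - exp (L k x)) \<longlonglongrightarrow> 0"
          by (rule Lim_null_comparison)
      qed
    qed auto
    then show ?thesis using exp_int by simp
  qed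
  have null_L: "(\<integral>x. exp (L k x) \<partial>P) \<le> 1" for k
  proof -
    have jensen: "exp (L k x) \<le> (\<integral>h. T (act h x) \<partial>D k)" for x
    proof -
      have "exp (\<integral>h. ln (T (act h x)) \<partial>D k) \<le> (\<integral>h. exp (ln (T (act h x))) \<partial>D k)"
        by (rule D.jensens_inequality[where I=UNIV])
           (use T T_pos ln_int exp_convex in \<open>auto intro!: D.integrable_const_bound[where B=N] simp: less_imp_le\<close>)
      then show ?thesis by (simp add: L_def T_pos)
    qed
    have T_int: "integrable (D k) (\<lambda>h. T (act h x))" for x
      by (rule D.integrable_const_bound[where B=N]) (use T T_pos in \<open>auto simp: less_imp_le\<close>)
    have "(\<integral>\<^sup>+x. ennreal (exp (L k x)) \<partial>P) \<le> (\<integral>\<^sup>+x. \<integral>\<^sup>+h. ennreal (T (act h x)) \<partial>D k \<partial>P)"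
      by (rule nn_integral_mono) (use jensen T_int T_pos in \<open>simp add: nn_integral_eq_integral less_imp_le\<close>)
    also have "\<dots> = (\<integral>\<^sup>+h. \<integral>\<^sup>+x. ennreal (T (act h x)) \<partial>P \<partial>D k)"
      by (rule PD.Fubini'[symmetric]) measurable
    also have "\<dots> \<le> (\<integral>\<^sup>+h. 1 \<partial>D k)" by (intro nn_integral_mono null)
    finally have "(\<integral>\<^sup>+x. ennreal (exp (L k x)) \<partial>P) \<le> 1" by (simp add: D.emeasure_space_1)
    then show ?thesis
      by (simp add: nn_integral_eq_integral[OF exp_int(1)])
  qed
  have growth_L: "v \<le> (\<integral>x. L k x \<partial>Q)" for k
  proof -
    have "integrable (Q \<Otimes>\<^sub>M D k) (\<lambda>(x, h). ln (T (act h x)))"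
    proof -
      interpret QDp: pair_prob_space Q "D k" ..
      show ?thesis by (rule QDp.integrable_const_bound[where B=b]) (use b in auto)
    qed
    from QD.Fubini_integral[OF this]
    have "(\<integral>x. L k x \<partial>Q) = (\<integral>h. \<integral>x. ln (T (act h x)) \<partial>Q \<partial>D k)" by (simp add: L_def)
    moreover have "(\<integral>h. v \<partial>D k) \<le> (\<integral>h. \<integral>x. ln (T (act h x)) \<partial>Q \<partial>D k)"
    proof (rule integral_mono)
      have "\<bar>\<integral>x. ln (T (act h x)) \<partial>Q\<bar> \<le> (\<integral>x. b \<partial>Q)" for h
        by (rule order_trans[OF integral_abs_bound integral_mono])
           (use b in \<open>auto intro!: Q.integrable_const_bound[where B=b]\<close>)
      then show "integrable (D k) (\<lambda>h. \<integral>x. ln (T (act h x)) \<partial>Q)"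
        by (intro D.integrable_const_bound[where B=b]) (auto simp: Q.prob_space)
    qed (use growth in auto)
    ultimately show ?thesis by (simp add: D.prob_space)
  qed
  have gibbs: "(\<integral>x. L' k x \<partial>Q) \<le> (\<integral>x. ln (R x) \<partial>Q) + (\<integral>x. exp (L' k x) \<partial>P) - 1" for k
  proof -
    have L'_sat: "L' k \<in> borel_measurable (saturated_algebra mX)"
    proof (rule measurable_saturated_algebra[OF L'_meas])
      fix x x' assume "mX x = mX x'"
      then obtain g where "x = act g x'" using mX unfolding maximal_invariant_def by blast
      then show "L' k x = L' k x'" by (simp add: L'_def)
    qed
    have "(\<integral>\<^sup>+x. ennreal (exp (L' k x) / R x) \<partial>Q) = (\<integral>\<^sup>+x. ennreal (R x) * ennreal (exp (L' k x) / R x) \<partial>P)"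
      by (rule LR) (use L'_sat R(1) in measurable)
    also have "\<dots> \<le> (\<integral>\<^sup>+x. ennreal (exp (L' k x)) \<partial>P)"
    proof (rule nn_integral_mono)
      fix x show "ennreal (R x) * ennreal (exp (L' k x) / R x) \<le> ennreal (exp (L' k x))"
        by (cases "0 < R x") (auto simp: ennreal_mult[symmetric] ennreal_neg)
    qed
    finally have W: "(\<integral>\<^sup>+x. ennreal (exp (L' k x) / R x) \<partial>Q) \<le> ennreal (\<integral>x. exp (L' k x) \<partial>P)"
      by (simp add: nn_integral_eq_integral[OF exp_int(2)])
    have W_int: "integrable Q (\<lambda>x. exp (L' k x) / R x)"
    proof (rule integrableI_nonneg)
      show "AE x in Q. 0 \<le> exp (L' k x) / R x" using R(2) by eventually_elim simp
      show "(\<integral>\<^sup>+x. ennreal (exp (L' k x) / R x) \<partial>Q) < \<infinity>"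
        using W by (rule le_less_trans) simp
    qed auto
    have "ennreal (\<integral>x. exp (L' k x) / R x \<partial>Q) \<le> ennreal (\<integral>x. exp (L' k x) \<partial>P)"
      using W by (subst (asm) nn_integral_eq_integral[OF W_int]) (use R(2) in \<open>auto elim!: eventually_mono\<close>)
    then have W_le: "(\<integral>x. exp (L' k x) / R x \<partial>Q) \<le> (\<integral>x. exp (L' k x) \<partial>P)"
      by (simp add: ennreal_le_iff)
    have "(\<integral>x. L' k x \<partial>Q) \<le> (\<integral>x. ln (R x) + (exp (L' k x) / R x - 1) \<partial>Q)"
    proof (rule integral_mono_AE)
      show "AE x in Q. L' k x \<le> ln (R x) + (exp (L' k x) / R x - 1)"
        using R(2)
      proof eventually_elim
        fix x assume "0 < R x"
        then have "ln (exp (L' k x) / R x) \<le> exp (L' k x) / R x - 1" by (intro ln_le_minus_one) simp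
        moreover have "ln (exp (L' k x) / R x) = L' k x - ln (R x)" using \<open>0 < R x\<close> by (simp add: ln_div)
        ultimately show "L' k x \<le> ln (R x) + (exp (L' k x) / R x - 1)" by linarith
      qed
    qed (use L_int W_int R(3) in auto)
    also have "\<dots> = (\<integral>x. ln (R x) \<partial>Q) + ((\<integral>x. exp (L' k x) / R x \<partial>Q) - 1)"
      using W_int R(3) by (simp add: Q.prob_space)
    finally show ?thesis using W_le by simp
  qed
  have "v \<le> (\<integral>x. ln (R x) \<partial>Q) + (((\<integral>x. L k x \<partial>Q) - (\<integral>x. L' k x \<partial>Q)) +
      ((\<integral>x. exp (L' k x) \<partial>P) - (\<integral>x. exp (L k x) \<partial>P)))" for k
    using growth_L[of k] gibbs[of k] null_L[of k] by linarith
  moreover have "(\<lambda>k. (\<integral>x. ln (R x) \<partial>Q) + (((\<integral>x. L k x \<partial>Q) - (\<integral>x. L' k x \<partial>Q)) +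
      ((\<integral>x. exp (L' k x) \<partial>P) - (\<integral>x. exp (L k x) \<partial>P)))) \<longlonglongrightarrow> (\<integral>x. ln (R x) \<partial>Q) + (0 + 0)"
    by (intro tendsto_add tendsto_const conv_Q conv_P)
  ultimately show ?thesis using LIMSEQ_le_const by fastforce
qed

text \<open>
Reduction to the bounded case. Capping \<open>T\<close> at \<open>N\<close> costs at most \<open>\<eta>\<close> for every group element,
and mixing the result with the constant 1 in the proportion \<open>1 - c\<close> to \<open>c\<close> costs
\<open>- ln (1 - c) = \<eta>\<close>, keeps the null expectations at most 1 and bounds the statistic away from 0.
\<close>

lemma worst_case_growth_bound:
  fixes P Q :: "'x measure" and mX :: "'x \<Rightarrow> 'm" and R T :: "'x \<Rightarrow> real"
    and D :: "nat \<Rightarrow> 'g measure"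
  assumes P: "prob_space P" "sets P = sets borel" and Q: "prob_space Q" "sets Q = sets borel"
    and mX: "maximal_invariant act mX"
    and R: "R \<in> borel_measurable (saturated_algebra mX)" "AE x in Q. 0 < R x"
      "integrable Q (\<lambda>x. ln (R x))"
    and LR: "\<And>h. h \<in> borel_measurable (saturated_algebra mX) \<Longrightarrow>
      (\<integral>\<^sup>+x. h x \<partial>Q) = (\<integral>\<^sup>+x. ennreal (R x) * h x \<partial>P)"
    and D: "\<And>k. prob_space (D k)" "\<And>k. sets (D k) = sets borel"
    and asymptotic: "\<And>B g. B \<in> sets borel \<Longrightarrow>
      (\<lambda>k. \<bar>measure (D k) B - measure (D k) ((\<lambda>h. h + g) ` B)\<bar>) \<longlonglongrightarrow> 0"
    and log_excess: "\<And>\<eta>. 0 < \<eta> \<Longrightarrow> \<exists>N\<ge>1. \<forall>T\<in>borel_measurable P. (\<forall>x. 0 \<le> T x) \<longrightarrow>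
      (\<integral>\<^sup>+x. ennreal (T x) \<partial>P) \<le> 1 \<longrightarrow> (\<integral>\<^sup>+x. ennreal (ln (max 1 (T x / N))) \<partial>Q) \<le> ennreal \<eta>"
    and T: "T \<in> borel_measurable borel" "\<And>x. 0 \<le> T x"
    and null: "\<And>g. (\<integral>\<^sup>+x. ennreal (T (act g x)) \<partial>P) \<le> 1"
  shows "(INF g. ext_expectation Q (\<lambda>x. ext_ln (T (act g x)))) \<le> ereal (\<integral>x. ln (R x) \<partial>Q)"
proof (rule ccontr)
  let ?K = "\<integral>x. ln (R x) \<partial>Q"
  assume "\<not> ?thesis"
  then have "ereal ?K < (INF g. ext_expectation Q (\<lambda>x. ext_ln (T (act g x))))" by simp
  then obtain v where v: "?K < v" "ereal v < (INF g. ext_expectation Q (\<lambda>x. ext_ln (T (act g x))))"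
    using ereal_dense2 by force
  interpret P: prob_space P by fact
  interpret Q: prob_space Q by fact
  note [measurable_cong] = P(2) Q(2)
  note [measurable] = T(1)
  have growth: "ereal v \<le> ext_expectation Q (\<lambda>x. ext_ln (T (act g x)))" for g
    using v(2) by (meson INF_lower UNIV_I less_imp_le order_trans)
  \<comment> \<open>Two losses of \<open>\<eta>\<close> each still leave the growth rate above the expectation of \<open>ln R\<close>.\<close>
  define \<eta> where "\<eta> = (v - ?K) / 3"
  have "0 < \<eta>" using v(1) by (simp add: \<eta>_def)
  obtain N where "1 \<le> N" and N: "\<And>T. T \<in> borel_measurable P \<Longrightarrow> (\<forall>x. 0 \<le> T x) \<Longrightarrow>
      (\<integral>\<^sup>+x. ennreal (T x) \<partial>P) \<le> 1 \<Longrightarrow> (\<integral>\<^sup>+x. ennreal (ln (max 1 (T x / N))) \<partial>Q) \<le> ennreal \<eta>"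
    using log_excess[OF \<open>0 < \<eta>\<close>] by blast
  have N_T: "(\<integral>\<^sup>+x. ennreal (ln (max 1 (T (act g x) / N))) \<partial>Q) \<le> ennreal \<eta>" for g
    by (rule N) (use T null in auto)
  have T_pos: "AE x in Q. 0 < T (act g x)" and ln_int: "integrable Q (\<lambda>x. ln (T (act g x)))" for g
  proof -
    have "(\<integral>\<^sup>+x. e2ennreal (ext_ln (T (act g x))) \<partial>Q) \<le> ennreal (ln N + \<eta>)"
      by (rule nn_integral_positive_log_le[OF Q(1) _ \<open>1 \<le> N\<close> _ N_T]) (use \<open>0 < \<eta>\<close> in auto)
    then have "(\<integral>\<^sup>+x. e2ennreal (ext_ln (T (act g x))) \<partial>Q) < \<infinity>"
      by (rule le_less_trans) simp
    moreover have "- \<infinity> < ext_expectation Q (\<lambda>x. ext_ln (T (act g x)))"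
      using growth[of g] by (rule less_le_trans[rotated]) simp
    ultimately show "AE x in Q. 0 < T (act g x)" "integrable Q (\<lambda>x. ln (T (act g x)))"
      by (rule integrable_ln_if_ext_expectation[rotated]; measurable)+
  qed
  have growth_T: "v \<le> (\<integral>x. ln (T (act g x)) \<partial>Q)" for g
    using growth[of g] by (simp add: ext_expectation_ln_eq_integral[OF T_pos ln_int])
  define c where "c = 1 - exp (- \<eta>)"
  have c: "0 < c" "c < 1" "ln (1 - c) = - \<eta>" using \<open>0 < \<eta>\<close> by (auto simp: c_def)
  define T' where "T' x = (1 - c) * min (T x) N + c" for x
  have T'_meas [measurable]: "T' \<in> borel_measurable borel" unfolding T'_def by measurable
  have T'_lower: "c \<le> T' x" for x
    unfolding T'_def using c T(2)[of x] \<open>1 \<le> N\<close> by simp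
  have T'_upper: "T' x \<le> N" for x
  proof -
    have "T' x \<le> (1 - c) * N + c * N"
      unfolding T'_def using c \<open>1 \<le> N\<close> by (intro add_mono mult_left_mono) auto
    then show ?thesis by (simp add: algebra_simps)
  qed
  have T'_null: "(\<integral>\<^sup>+x. ennreal (T' (act g x)) \<partial>P) \<le> 1" for g
  proof -
    have "(\<integral>\<^sup>+x. ennreal (T' (act g x)) \<partial>P) \<le> (\<integral>\<^sup>+x. ennreal (1 - c) * ennreal (T (act g x)) + ennreal c \<partial>P)"
    proof (rule nn_integral_mono)
      fix x
      have "T' (act g x) \<le> (1 - c) * T (act g x) + c"
        unfolding T'_def using c by (intro add_right_mono mult_left_mono) auto
      then show "ennreal (T' (act g x)) \<le> ennreal (1 - c) * ennreal (T (act g x)) + ennreal c"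
        using c T(2) by (simp add: ennreal_mult[symmetric] ennreal_plus[symmetric] ennreal_leI del: ennreal_plus)
    qed
    also have "\<dots> = ennreal (1 - c) * (\<integral>\<^sup>+x. ennreal (T (act g x)) \<partial>P) + ennreal c"
      by (subst nn_integral_add) (auto simp: nn_integral_cmult P.emeasure_space_1)
    also have "\<dots> \<le> ennreal (1 - c) * 1 + ennreal c"
      by (intro add_right_mono mult_left_mono null) simp
    also have "\<dots> = 1" using c by (simp flip: ennreal_plus)
    finally show ?thesis .
  qed
  have T'_growth: "v - 2 * \<eta> \<le> (\<integral>x. ln (T' (act g x)) \<partial>Q)" for g
  proof -
    let ?e = "\<lambda>x. ln (max 1 (T (act g x) / N))"
    have e_int: "integrable Q ?e"
      by (rule integrableI_nonneg) (use N_T[of g] in \<open>auto intro: le_less_trans\<close>)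
    have "ennreal (\<integral>x. ?e x \<partial>Q) \<le> ennreal \<eta>"
      using N_T[of g] by (subst (asm) nn_integral_eq_integral[OF e_int]) auto
    then have e_le: "(\<integral>x. ?e x \<partial>Q) \<le> \<eta>" using \<open>0 < \<eta>\<close> by (simp add: ennreal_le_iff)
    have T'_int: "integrable Q (\<lambda>x. ln (T' (act g x)))"
    proof (rule Q.integrable_const_bound[where B="\<bar>ln c\<bar> + \<bar>ln N\<bar>"], rule AE_I2)
      fix x
      have "0 < T' (act g x)" using c T'_lower[of "act g x"] by simp
      then have "ln c \<le> ln (T' (act g x))" "ln (T' (act g x)) \<le> ln N"
        using c T'_lower[of "act g x"] T'_upper[of "act g x"] by auto
      then show "norm (ln (T' (act g x))) \<le> \<bar>ln c\<bar> + \<bar>ln N\<bar>" unfolding real_norm_def by linarith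
    qed measurable
    have "(\<integral>x. ln (T (act g x)) - ?e x - \<eta> \<partial>Q) \<le> (\<integral>x. ln (T' (act g x)) \<partial>Q)"
    proof (rule integral_mono_AE)
      show "AE x in Q. ln (T (act g x)) - ?e x - \<eta> \<le> ln (T' (act g x))"
        using T_pos[of g]
      proof eventually_elim
        fix x assume pos: "0 < T (act g x)"
        have "T (act g x) = min (T (act g x)) N * max 1 (T (act g x) / N)"
          using \<open>1 \<le> N\<close> by (auto simp: min_def max_def field_simps)
        then have "ln (T (act g x)) = ln (min (T (act g x)) N) + ?e x"
          using pos \<open>1 \<le> N\<close> ln_mult_pos[of "min (T (act g x)) N" "max 1 (T (act g x) / N)"] by simp
        moreover have "ln ((1 - c) * min (T (act g x)) N) = ln (1 - c) + ln (min (T (act g x)) N)"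
          using pos \<open>1 \<le> N\<close> c by (intro ln_mult_pos) auto
        moreover have "ln ((1 - c) * min (T (act g x)) N) \<le> ln (T' (act g x))"
          unfolding T'_def using pos \<open>1 \<le> N\<close> c by (subst ln_le_cancel_iff) (auto intro!: mult_pos_pos add_pos_pos)
        ultimately show "ln (T (act g x)) - ?e x - \<eta> \<le> ln (T' (act g x))" using c(3) by linarith
      qed
    qed (use ln_int e_int T'_int in auto)
    moreover have "(\<integral>x. ln (T (act g x)) - ?e x - \<eta> \<partial>Q) = (\<integral>x. ln (T (act g x)) \<partial>Q) - (\<integral>x. ?e x \<partial>Q) - \<eta>"
      using ln_int e_int by (simp add: Q.prob_space)
    ultimately show ?thesis using growth_T[of g] e_le by linarith
  qed
  have "v - 2 * \<eta> \<le> ?K"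
    by (rule bounded_growth_bound[OF P Q mX R LR D asymptotic T'_meas c(1) T'_lower T'_upper T'_null T'_growth])
  then show False using \<open>0 < \<eta>\<close> by (simp add: \<eta>_def field_simps)
qed

end

text \<open>
If the best growth rate attainable against a single alternative is the same finite number for all
alternatives, then the relative criterion is the absolute one shifted by that number.
\<close>

lemma relatively_GROW_if_GROW:
  assumes grow: "GROW P Q T" and T: "\<And>g. ext_expectation (Q g) (\<lambda>x. ext_ln (T x)) = ereal K"
    and best: "\<And>g. (SUP T'\<in>{T'. e_statistic P T'}. ext_expectation (Q g) (\<lambda>x. ext_ln (T' x))) = ereal v"
  shows "relatively_GROW P Q T"
  unfolding relatively_GROW_def
proof (intro conjI allI impI)
  show "e_statistic P T" using grow by (simp add: GROW_def)
  fix T' assume T': "e_statistic P T'"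
  have growth: "relative_growth P Q U = (INF g. ext_expectation (Q g) (\<lambda>x. ext_ln (U x)) - ereal v)" for U
    unfolding relative_growth_def best ..
  have "relative_growth P Q T' + ereal v \<le> (INF g. ext_expectation (Q g) (\<lambda>x. ext_ln (T' x)))"
  proof (rule INF_greatest)
    fix g
    have "relative_growth P Q T' \<le> ext_expectation (Q g) (\<lambda>x. ext_ln (T' x)) - ereal v"
      unfolding growth by (rule INF_lower) simp
    then show "relative_growth P Q T' + ereal v \<le> ext_expectation (Q g) (\<lambda>x. ext_ln (T' x))"
      by (simp add: ereal_le_minus)
  qed
  also have "\<dots> \<le> (INF g. ext_expectation (Q g) (\<lambda>x. ext_ln (T x)))"
    using grow T' unfolding GROW_def by blast
  also have "\<dots> = ereal K" unfolding T by simp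
  finally have "relative_growth P Q T' \<le> ereal K - ereal v" by (subst ereal_le_minus) simp_all
  also have "\<dots> = relative_growth P Q T" unfolding growth T by simp
  finally show "relative_growth P Q T' \<le> relative_growth P Q T" .
qed

section \<open>The likelihood ratio of the maximal invariant of a sufficient statistic\<close>

theorem corollary12:
  fixes actX :: "'g::{topological_group_add,polish_space} \<Rightarrow> 'x::polish_space \<Rightarrow> 'x"
    and actT :: "'g \<Rightarrow> 't \<Rightarrow> 't"
    and actS :: "'g \<Rightarrow> 's::topological_space \<Rightarrow> 's"
    and P :: "'t \<Rightarrow> 'x measure"
    and \<delta> :: "'t \<Rightarrow> 'd" and \<delta>\<^sub>0 \<delta>\<^sub>1 :: 'd and \<theta>\<^sub>0 \<theta>\<^sub>1 :: 't
    and PG QG :: "'g \<Rightarrow> 'x measure"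
    and \<mu> :: "'x measure" and \<kappa> :: "'g \<Rightarrow> real"
    and p q :: "'g \<Rightarrow> 'x \<Rightarrow> real"
    and s :: "'x \<Rightarrow> 's"
    and mX :: "'x \<Rightarrow> 'mx" and \<nu>X :: "'mx measure" and pMX qMX :: "'mx \<Rightarrow> real"
    and mS :: "'s \<Rightarrow> 'ms" and \<nu>S :: "'ms measure" and pMS qMS :: "'ms \<Rightarrow> real"
  assumes G_locally_compact: "locally_compact_space (euclidean :: 'g topology)"
    and X_locally_compact: "locally_compact_space (euclidean :: 'x topology)"
    and actX: "group_action_on actX" "free_action actX" "continuous_action actX"
      "proper_action actX"
    and actT: "group_action_on actT" "free_action actT"
    and model: "\<And>\<theta>. prob_space (P \<theta>)" "\<And>\<theta>. sets (P \<theta>) = sets borel"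
    and invariant: "invariant_model actX actT P"
    and \<delta>: "maximal_invariant actT \<delta>" "\<delta> \<theta>\<^sub>0 = \<delta>\<^sub>0" "\<delta> \<theta>\<^sub>1 = \<delta>\<^sub>1"
    and PG: "\<And>g. PG g = P (actT g \<theta>\<^sub>0)"
    and QG: "\<And>g. QG g = P (actT g \<theta>\<^sub>1)"
    and \<mu>: "sets \<mu> = sets borel" "multiplier \<kappa>" "relatively_left_invariant actX \<kappa> \<mu>"
    and p: "\<And>g. p g \<in> borel_measurable borel" "\<And>g x. 0 \<le> p g x"
      "\<And>g. PG g = density \<mu> (\<lambda>x. ennreal (p g x))"
    and q: "\<And>g. q g \<in> borel_measurable borel" "\<And>g x. 0 \<le> q g x"
      "\<And>g. QG g = density \<mu> (\<lambda>x. ennreal (q g x))"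
    and common_support: "\<exists>A. \<forall>g. {x. 0 < p g x} = A \<and> {x. 0 < q g x} = A"
    and S_standard_borel: "standard_borel (borel :: 's measure)"
    and s_sufficient: "sufficient_statistic P borel s"
    and actS: "group_action_on actS" "free_action actS" "continuous_action actS"
    and s_equivariant: "\<And>g x. s (actX g x) = actS g (s x)"
    and mX: "standard_borel \<nu>X" "mX \<in> borel \<rightarrow>\<^sub>M \<nu>X" "maximal_invariant actX mX"
    and pMX: "\<And>y. 0 \<le> pMX y" "\<And>g. distributed (PG g) \<nu>X mX (\<lambda>y. ennreal (pMX y))"
    and qMX: "\<And>y. 0 \<le> qMX y" "\<And>g. distributed (QG g) \<nu>X mX (\<lambda>y. ennreal (qMX y))"
    and mS: "standard_borel \<nu>S" "mS \<in> borel \<rightarrow>\<^sub>M \<nu>S" "maximal_invariant actS mS"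
    and pMS: "\<And>y. 0 \<le> pMS y" "\<And>g. distributed (PG g) \<nu>S (mS \<circ> s) (\<lambda>y. ennreal (pMS y))"
    and qMS: "\<And>y. 0 \<le> qMS y" "\<And>g. distributed (QG g) \<nu>S (mS \<circ> s) (\<lambda>y. ennreal (qMS y))"
  shows "(\<forall>g. (AE x in PG g. qMX (mX x) / pMX (mX x) = qMS (mS (s x)) / pMS (mS (s x))) \<and>
              (AE x in QG g. qMX (mX x) / pMX (mX x) = qMS (mS (s x)) / pMS (mS (s x)))) \<and>
         (amenable TYPE('g) \<and>
          (\<exists>\<epsilon>>0. (\<integral>\<^sup>+ x. ennreal (\<bar>ln (q 0 x / p 0 x)\<bar> powr (1 + \<epsilon>)) \<partial>QG 0) < \<infinity> \<and>
                 (\<integral>\<^sup>+ x. ennreal (\<bar>ln (qMX (mX x) / pMX (mX x))\<bar> powr (1 + \<epsilon>)) \<partial>QG 0) < \<infinity>)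
          \<longrightarrow> GROW PG QG (\<lambda>x. qMS (mS (s x)) / pMS (mS (s x))) \<and>
              relatively_GROW PG QG (\<lambda>x. qMS (mS (s x)) / pMS (mS (s x))))"
proof -
  interpret X: free_proper_action actX by unfold_locales (rule actX)+
  let ?P = "PG 0" and ?Q = "QG 0"
  let ?RX = "\<lambda>x. qMX (mX x) / pMX (mX x)" and ?RS = "\<lambda>x. qMS (mS (s x)) / pMS (mS (s x))"
  have P0: "?P = P \<theta>\<^sub>0" and Q0: "?Q = P \<theta>\<^sub>1"
    using actT(1) by (simp_all add: PG QG group_action_on_def)
  have prob: "prob_space (PG g)" "prob_space (QG g)"
    and sets_PG: "sets (PG g) = sets borel" and sets_QG: "sets (QG g) = sets borel" for g
    by (simp_all add: PG QG model)
  note [measurable_cong] = sets_PG sets_QG \<mu>(1)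
  obtain A where A: "\<And>g x. 0 < p g x \<longleftrightarrow> x \<in> A" "\<And>g x. 0 < q g x \<longleftrightarrow> x \<in> A"
    using common_support by blast
  \<comment> \<open>All distributions of the testing problem have the same null sets.\<close>
  have null_density: "null_sets (density \<mu> (\<lambda>x. ennreal (d x))) = {B \<in> sets \<mu>. AE x in \<mu>. x \<in> B \<longrightarrow> x \<notin> A}"
    if [measurable]: "d \<in> borel_measurable borel" and d: "\<And>x. 0 \<le> d x" "\<And>x. 0 < d x \<longleftrightarrow> x \<in> A"
    for d :: "'x \<Rightarrow> real"
  proof -
    have "ennreal (d x) = 0 \<longleftrightarrow> x \<notin> A" for x using d(1)[of x] d(2)[of x] by auto
    then show ?thesis by (auto simp: null_sets_density_iff)
  qed
  have null_PG: "null_sets (PG g) = null_sets ?P" and null_QG: "null_sets (QG g) = null_sets ?P" for g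
    using null_density[OF p(1,2) A(1), of g] null_density[OF p(1,2) A(1), of 0]
      null_density[OF q(1,2) A(2), of g] by (simp_all only: p(3)[symmetric] q(3)[symmetric])
  have shift_P: "PG g = distr ?P borel (actX g)" and shift_Q: "QG g = distr ?Q borel (actX g)" for g
    unfolding PG[of g] QG[of g] P0 Q0
    by (rule distr_action_invariant_model[OF invariant actX(1) model]; measurable)+
  have quasi: "{x. actX g x \<in> B} \<in> null_sets (P \<theta>\<^sub>0)" if "B \<in> null_sets (P \<theta>\<^sub>0)" for g B
  proof -
    have "B \<in> null_sets (distr ?P borel (actX g))"
      using that by (simp only: P0[symmetric] shift_P[symmetric] null_PG[of g])
    then show ?thesis
      using sets_eq_imp_space_eq[OF sets_PG[of 0]]
      by (subst (asm) null_sets_distr_iff) (measurable, simp add: P0 vimage_def)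
  qed
  have abs_cont: "absolutely_continuous ?P (QG g)" "absolutely_continuous ?P (PG g)"
    "absolutely_continuous (PG g) (QG g)" for g
    using null_PG[of g] null_QG[of g] by (simp_all add: absolutely_continuous_def)
  have mS_s: "distributed (PG g) \<nu>S (\<lambda>x. mS (s x)) (\<lambda>y. ennreal (pMS y))"
    "distributed (QG g) \<nu>S (\<lambda>x. mS (s x)) (\<lambda>y. ennreal (qMS y))" for g
    using pMS(2)[of g] qMS(2)[of g] by (simp_all add: o_def)
  have LR_eq: "AE x in ?P. ?RX x = ?RS x"
    unfolding P0
    by (rule X.likelihood_ratio_of_sufficient_maximal_invariant[OF model invariant s_sufficient actS(1,3)
        s_equivariant quasi _ mX pMX(1) _ qMX(1) _ mS pMS(1) _ qMS(1)])
       (use abs_cont(1)[of 0] pMX(2)[of 0] qMX(2)[of 0] mS_s[of 0] in \<open>simp_all add: P0 Q0\<close>)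
  have LR_eq_all: "AE x in PG g. ?RX x = ?RS x" "AE x in QG g. ?RX x = ?RS x" for g
    by (rule absolutely_continuous_AE[OF _ abs_cont(2) LR_eq], simp add: sets_PG)
      (rule absolutely_continuous_AE[OF _ abs_cont(1) LR_eq], simp add: sets_PG sets_QG)
  moreover have "GROW PG QG ?RS \<and> relatively_GROW PG QG ?RS"
    if amenable: "amenable TYPE('g)" and "0 < \<epsilon>"
      and q_moment: "(\<integral>\<^sup>+x. ennreal (\<bar>ln (q 0 x / p 0 x)\<bar> powr (1 + \<epsilon>)) \<partial>?Q) < \<infinity>"
      and M_moment: "(\<integral>\<^sup>+x. ennreal (\<bar>ln (?RX x)\<bar> powr (1 + \<epsilon>)) \<partial>?Q) < \<infinity>" for \<epsilon>
  proof -
    interpret P: prob_space ?P by (rule prob)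
    interpret Q: prob_space ?Q by (rule prob)
    have [measurable]: "s \<in> borel_measurable borel"
      using s_sufficient by (simp add: sufficient_statistic_def)
    have [measurable]: "mX \<in> borel \<rightarrow>\<^sub>M \<nu>X" "mS \<in> borel \<rightarrow>\<^sub>M \<nu>S" by fact+
    have [measurable]: "pMX \<in> borel_measurable \<nu>X" "qMX \<in> borel_measurable \<nu>X"
      "pMS \<in> borel_measurable \<nu>S" "qMS \<in> borel_measurable \<nu>S"
      using distributed_real_measurable[OF pMX(1) pMX(2)] distributed_real_measurable[OF qMX(1) qMX(2)]
        distributed_real_measurable[OF pMS(1) pMS(2)] distributed_real_measurable[OF qMS(1) qMS(2)]
      by simp_all
    have [measurable]: "p 0 \<in> borel_measurable borel" "q 0 \<in> borel_measurable borel" by (rule p q)+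
    have integrable_if_moment: "integrable ?Q f"
      if [measurable]: "f \<in> borel_measurable borel"
        and moment: "(\<integral>\<^sup>+x. ennreal (\<bar>f x\<bar> powr (1 + \<epsilon>)) \<partial>?Q) < \<infinity>" for f :: "'x \<Rightarrow> real"
    proof (rule Bochner_Integration.integrable_bound)
      have "integrable ?Q (\<lambda>x. \<bar>f x\<bar> powr (1 + \<epsilon>))"
        by (rule integrableI_nonneg) (use moment in auto)
      then show "integrable ?Q (\<lambda>x. 1 + \<bar>f x\<bar> powr (1 + \<epsilon>))" by simp
      have "\<bar>f x\<bar> \<le> 1 + \<bar>f x\<bar> powr (1 + \<epsilon>)" for x
      proof (cases "\<bar>f x\<bar> \<le> 1")
        case True
        then show ?thesis by (meson add_increasing2 order_trans powr_ge_zero order_refl le_add_same_cancel1)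
      next
        case False
        then have "\<bar>f x\<bar> powr 1 \<le> \<bar>f x\<bar> powr (1 + \<epsilon>)"
          using \<open>0 < \<epsilon>\<close> by (intro powr_mono) auto
        then show ?thesis using False by simp
      qed
      then show "AE x in ?Q. norm (f x) \<le> norm (1 + \<bar>f x\<bar> powr (1 + \<epsilon>))" by simp
    qed measurable
    define K where "K = (\<integral>x. ln (?RX x) \<partial>?Q)"
    have lnRX_int: "integrable ?Q (\<lambda>x. ln (?RX x))"
      by (rule integrable_if_moment[OF _ M_moment]) measurable
    let ?r = "\<lambda>x. q 0 x / p 0 x"
    have lnr_int: "integrable ?Q (\<lambda>x. ln (?r x))"
      by (rule integrable_if_moment[OF _ q_moment]) measurable
    have r_pos: "AE x in ?Q. 0 < ?r x"
      unfolding q(3)[of 0] by (subst AE_density) (use A in \<open>auto intro!: AE_I2 divide_pos_pos\<close>)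
    have Q_density: "?Q = density ?P (\<lambda>x. ennreal (?r x))"
    proof -
      have "ennreal (p 0 x) * ennreal (?r x) = ennreal (q 0 x)" for x
      proof (cases "x \<in> A")
        case True
        then show ?thesis using A(1)[of 0 x] p(2)[of 0 x] q(2)[of 0 x] by (simp add: ennreal_mult[symmetric])
      next
        case False
        then show ?thesis using A[of 0 x] p(2)[of 0 x] q(2)[of 0 x] by simp
      qed
      then show ?thesis unfolding p(3)[of 0] q(3)[of 0] by (subst density_density_eq) auto
    qed
    have log_excess: "\<exists>N\<ge>1. \<forall>T\<in>borel_measurable ?P. (\<forall>x. 0 \<le> T x) \<longrightarrow>
      (\<integral>\<^sup>+x. ennreal (T x) \<partial>?P) \<le> 1 \<longrightarrow> (\<integral>\<^sup>+x. ennreal (ln (max 1 (T x / N))) \<partial>?Q) \<le> ennreal \<eta>"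
      if "0 < \<eta>" for \<eta>
      by (rule uniformly_small_log_excess[OF _ r_pos prob(2) Q_density lnr_int that]) measurable
    have RX_pos: "AE x in ?Q. 0 < ?RX x"
    proof -
      have "AE x in ?Q. 0 < pMX (mX x)"
        by (rule absolutely_continuous_AE[OF _ abs_cont(1) distributed_density_pos[OF pMX]]) (simp add: sets_PG sets_QG)
      with distributed_density_pos[OF qMX, of 0] show ?thesis by eventually_elim simp
    qed
    have RX_sat: "?RX \<in> borel_measurable (saturated_algebra mX)"
      by (rule measurable_saturated_algebra) (simp_all, measurable)
    note LR = likelihood_ratio_on_saturated_algebra[OF P.finite_measure_axioms sets_PG sets_QG abs_cont(3)]
    obtain D :: "nat \<Rightarrow> 'g measure" where D: "\<And>k. prob_space (D k)" "\<And>k. sets (D k) = sets borel"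
      and asymptotic: "\<And>B g. B \<in> sets borel \<Longrightarrow>
        (\<lambda>k. \<bar>measure (D k) B - measure (D k) ((\<lambda>h. h + g) ` B)\<bar>) \<longlonglongrightarrow> 0"
      using amenable unfolding amenable_def by blast
    have e_statistic_iff: "e_statistic PG T \<longleftrightarrow> T \<in> borel_measurable borel \<and> (\<forall>x. 0 \<le> T x) \<and>
        (\<forall>g. (\<integral>\<^sup>+x. ennreal (T (actX g x)) \<partial>?P) \<le> 1)" for T
    proof -
      have "(\<integral>\<^sup>+x. ennreal (T x) \<partial>PG g) = (\<integral>\<^sup>+x. ennreal (T (actX g x)) \<partial>?P)"
        if [measurable]: "T \<in> borel_measurable borel" for g
        unfolding shift_P[of g] by (rule nn_integral_distr) measurable
      then show ?thesis unfolding e_statistic_def by (auto simp: SUP_le_iff)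
    qed
    \<comment> \<open>Growth under \<open>QG g\<close> is growth of a translated statistic under one fixed alternative.\<close>
    have ext_shift: "ext_expectation (QG g) (\<lambda>x. ext_ln (T x)) = ext_expectation ?Q (\<lambda>x. ext_ln (T (actX g x)))"
      if [measurable]: "T \<in> borel_measurable borel" for T g
    proof -
      have "(\<integral>\<^sup>+x. e2ennreal (ext_ln (T x)) \<partial>QG g) = (\<integral>\<^sup>+x. e2ennreal (ext_ln (T (actX g x))) \<partial>?Q)"
        "(\<integral>\<^sup>+x. e2ennreal (- ext_ln (T x)) \<partial>QG g) = (\<integral>\<^sup>+x. e2ennreal (- ext_ln (T (actX g x))) \<partial>?Q)"
        unfolding shift_Q[of g] by (rule nn_integral_distr; measurable)+
      then show ?thesis by (simp add: ext_expectation_def)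
    qed
    have RS_meas: "?RS \<in> borel_measurable borel" by measurable
    have RS_act: "?RS (actX g x) = ?RS x" for g x
    proof -
      have "mS (s (actX g x)) = mS (s x)"
        using mS(3) unfolding s_equivariant maximal_invariant_def by blast
      then show ?thesis by simp
    qed
    have RS_e: "e_statistic PG ?RS"
      unfolding e_statistic_iff RS_act
    proof (intro conjI allI)
      have "(\<integral>\<^sup>+x. ennreal (?RS x) * 1 \<partial>?P) = (\<integral>\<^sup>+x. 1 \<partial>?Q)"
        by (rule LR[OF mS(1) _ pMS(1) mS_s(1) qMS(1) mS_s(2), symmetric]) measurable
      then show "(\<integral>\<^sup>+x. ennreal (?RS x) \<partial>?P) \<le> 1" by (simp add: Q.emeasure_space_1)
    qed (use RS_meas pMS(1) qMS(1) in auto)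
    have RS_growth: "ext_expectation (QG g) (\<lambda>x. ext_ln (?RS x)) = ereal K" for g
    proof -
      have eq: "AE x in ?Q. ?RX x = ?RS x" by (rule LR_eq_all)
      have "AE x in ?Q. 0 < ?RS x" using eq RX_pos by eventually_elim simp
      moreover have "integrable ?Q (\<lambda>x. ln (?RS x))"
        by (rule integrable_cong_AE_imp[OF lnRX_int]) (measurable, use eq in eventually_elim, simp)
      ultimately have "ext_expectation ?Q (\<lambda>x. ext_ln (?RS x)) = ereal (\<integral>x. ln (?RS x) \<partial>?Q)"
        by (rule ext_expectation_ln_eq_integral)
      also have "(\<integral>x. ln (?RS x) \<partial>?Q) = K"
        unfolding K_def by (rule integral_cong_AE) (measurable, use eq in eventually_elim, simp)
      finally show ?thesis unfolding ext_shift[OF RS_meas, of g] RS_act .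
    qed
    have grow: "GROW PG QG ?RS"
      unfolding GROW_def
    proof (intro conjI allI impI RS_e)
      fix T assume "e_statistic PG T"
      then have T: "T \<in> borel_measurable borel" "\<And>x. 0 \<le> T x"
        "\<And>g. (\<integral>\<^sup>+x. ennreal (T (actX g x)) \<partial>?P) \<le> 1" by (simp_all add: e_statistic_iff)
      have "(INF g. ext_expectation ?Q (\<lambda>x. ext_ln (T (actX g x)))) \<le> ereal K"
        unfolding K_def
        by (rule X.worst_case_growth_bound[OF prob(1) sets_PG prob(2) sets_QG mX(3) RX_sat RX_pos lnRX_int
              LR[OF mX(1,2) pMX qMX] D asymptotic log_excess T])
      moreover have "(INF g. ext_expectation (QG g) (\<lambda>x. ext_ln (T x))) =
          (INF g. ext_expectation ?Q (\<lambda>x. ext_ln (T (actX g x))))"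
        by (rule INF_cong[OF refl ext_shift[OF T(1)]])
      ultimately show "(INF g. ext_expectation (QG g) (\<lambda>x. ext_ln (T x))) \<le>
          (INF g. ext_expectation (QG g) (\<lambda>x. ext_ln (?RS x)))"
        unfolding RS_growth by simp
    qed
    define V where "V g = (SUP T\<in>{T. e_statistic PG T}. ext_expectation (QG g) (\<lambda>x. ext_ln (T x)))" for g
    \<comment> \<open>Translation maps e-statistics to e-statistics and alternatives to alternatives.\<close>
    have V_le: "V g \<le> V h" for g h
      unfolding V_def
    proof (rule SUP_least)
      fix T assume "T \<in> {T. e_statistic PG T}"
      then have T: "T \<in> borel_measurable borel" "\<And>x. 0 \<le> T x"
        "\<And>g. (\<integral>\<^sup>+x. ennreal (T (actX g x)) \<partial>?P) \<le> 1" by (simp_all add: e_statistic_iff)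
      let ?T = "\<lambda>x. T (actX (g + - h) x)"
      have T'_meas: "?T \<in> borel_measurable borel" by (rule measurable_compose[OF _ T(1)]) measurable
      have "e_statistic PG ?T"
        unfolding e_statistic_iff using T'_meas T by (simp flip: X.act_add)
      moreover have "ext_expectation (QG h) (\<lambda>x. ext_ln (?T x)) = ext_expectation (QG g) (\<lambda>x. ext_ln (T x))"
        unfolding ext_shift[OF T'_meas, of h] ext_shift[OF T(1), of g] by (simp flip: X.act_add add: add.assoc)
      ultimately show "ext_expectation (QG g) (\<lambda>x. ext_ln (T x)) \<le>
          (SUP T\<in>{T. e_statistic PG T}. ext_expectation (QG h) (\<lambda>x. ext_ln (T x)))"
        by (intro SUP_upper2[of ?T]) simp_all
    qed
    have "ereal K \<le> V 0"
      unfolding V_def RS_growth[of 0, symmetric] by (rule SUP_upper) (simp add: RS_e)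
    \<comment> \<open>The cap \<open>N\<close> that leaves at most 1 of log excess bounds the growth of all e-statistics.\<close>
    moreover have "V 0 < \<infinity>"
    proof -
      obtain N :: real where N: "1 \<le> N" "\<And>T. T \<in> borel_measurable ?P \<Longrightarrow> (\<forall>x. 0 \<le> T x) \<Longrightarrow>
          (\<integral>\<^sup>+x. ennreal (T x) \<partial>?P) \<le> 1 \<Longrightarrow> (\<integral>\<^sup>+x. ennreal (ln (max 1 (T x / N))) \<partial>?Q) \<le> ennreal 1"
        using log_excess[of 1] by auto
      have "V 0 \<le> ereal (ln N + 1)"
        unfolding V_def
      proof (rule SUP_least)
        fix T assume "T \<in> {T. e_statistic PG T}"
        then have T [measurable]: "T \<in> borel_measurable borel" and T_nonneg: "\<And>x. 0 \<le> T x"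
          and "\<And>g. (\<integral>\<^sup>+x. ennreal (T (actX g x)) \<partial>?P) \<le> 1" by (simp_all add: e_statistic_iff)
        from this(3)[of 0] have T_null: "(\<integral>\<^sup>+x. ennreal (T x) \<partial>?P) \<le> 1" by simp
        have pos: "(\<integral>\<^sup>+x. e2ennreal (ext_ln (T x)) \<partial>?Q) \<le> ennreal (ln N + 1)"
          by (rule nn_integral_positive_log_le[OF prob(2) _ N(1) _ N(2)]) (use T_nonneg T_null in auto)
        have "enn2ereal (\<integral>\<^sup>+x. e2ennreal (ext_ln (T x)) \<partial>?Q) \<le> ereal (ln N + 1)"
          using pos N(1) by (metis add_nonneg_nonneg enn2ereal_ennreal less_eq_ennreal.rep_eq ln_ge_zero zero_le_one)
        moreover have "a - enn2ereal b \<le> a" for a b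
          by (rule ereal_diff_le_self) simp
        ultimately show "ext_expectation ?Q (\<lambda>x. ext_ln (T x)) \<le> ereal (ln N + 1)"
          unfolding ext_expectation_def Let_def by (auto intro: order_trans)
      qed
      then show ?thesis by (rule le_less_trans) simp
    qed
    ultimately obtain v where "V 0 = ereal v" by (cases "V 0") auto
    then have "V g = ereal v" for g using V_le[of g 0] V_le[of 0 g] by simp
    then have "relatively_GROW PG QG ?RS"
      using relatively_GROW_if_GROW[OF grow RS_growth] unfolding V_def by blast
    with grow show ?thesis by blast
  qed
  ultimately show ?thesis by blast
qed

end
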